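(* The category $\mathsf{MV}_{\mathsf{lf}}$ of locally finite MV-algebras has no regularly generating finite set of finitely generated objects.
   Context: MV-algebras: an MV-algebra is an algebra $\langle A,\oplus,\neg,0\rangle$ such that $\langle A,\oplus,0\rangle$ is a monoid, $\neg\neg x=x$, $\neg 0\oplus x=\neg 0$, and $\neg(\neg x\oplus y)\oplus y=\neg(\neg y\oplus x)\oplus x$. An MV-algebra is locally finite if each of its finitely generated subalgebras is finite. $\mathsf{MV}_{\mathsf{lf}}$ has all locally finite MV-algebras as objects and all MV-homomorphisms between them as arrows. It is complete and cocomplete. Categorical notions: in a category with coproducts, a set of objects $\mathcal{G}$ is regularly generating if, for every object $A$, the canonical arrow $\sum_{G\in\mathcal{G},\,h\in\hom(G,A)}G\to A$, whose $(G,h)$-component is $h$, is regular epic (i.e. a coequaliser of some pair of parallel arrows). An object $A$ of a category $\mathsf{C}$ is finitely generated if $\hom(A,-)\colon\mathsf{C}\to\mathsf{Set}$ preserves colimits of those filtered diagrams all of whose transition arrows are monic in $\mathsf{C}$. *)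

theory Defs
  imports "HOL-Algebra.Group" "HOL-Library.Equipollence"
begin

section \<open>Categories\<close>

record ('o, 'a) category =
  Obj :: "'o set"
  Arr :: "'a set"
  Dom :: "'a \<Rightarrow> 'o"
  Cod :: "'a \<Rightarrow> 'o"
  Id :: "'o \<Rightarrow> 'a"
  Comp :: "'a \<Rightarrow> 'a \<Rightarrow> 'a"

definition Hom :: "('o, 'a) category \<Rightarrow> 'o \<Rightarrow> 'o \<Rightarrow> 'a set" where
  "Hom C X Y = {f \<in> Arr C. Dom C f = X \<and> Cod C f = Y}"

text \<open>\<open>Comp C g f\<close> is \<open>g\<close> after \<open>f\<close>; it is unconstrained when \<open>f\<close> and \<open>g\<close> do not compose.\<close>

definition is_category :: "('o, 'a) category \<Rightarrow> bool" where
  "is_category C \<longleftrightarrow>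
     (\<forall>f \<in> Arr C. Dom C f \<in> Obj C \<and> Cod C f \<in> Obj C) \<and>
     (\<forall>X \<in> Obj C. Id C X \<in> Hom C X X) \<and>
     (\<forall>X Y Z. \<forall>f \<in> Hom C X Y. \<forall>g \<in> Hom C Y Z. Comp C g f \<in> Hom C X Z) \<and>
     (\<forall>X Y. \<forall>f \<in> Hom C X Y. Comp C f (Id C X) = f \<and> Comp C (Id C Y) f = f) \<and>
     (\<forall>W X Y Z. \<forall>f \<in> Hom C W X. \<forall>g \<in> Hom C X Y. \<forall>h \<in> Hom C Y Z.
        Comp C h (Comp C g f) = Comp C (Comp C h g) f)"

definition is_functor ::
    "('i, 'j) category \<Rightarrow> ('o, 'a) category \<Rightarrow> ('i \<Rightarrow> 'o) \<Rightarrow> ('j \<Rightarrow> 'a) \<Rightarrow> bool" where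
  "is_functor J C Fo Fa \<longleftrightarrow>
     is_category J \<and> is_category C \<and>
     (\<forall>i \<in> Obj J. Fo i \<in> Obj C) \<and>
     (\<forall>i j. \<forall>u \<in> Hom J i j. Fa u \<in> Hom C (Fo i) (Fo j)) \<and>
     (\<forall>i \<in> Obj J. Fa (Id J i) = Id C (Fo i)) \<and>
     (\<forall>i j k. \<forall>u \<in> Hom J i j. \<forall>v \<in> Hom J j k. Fa (Comp J v u) = Comp C (Fa v) (Fa u))"

definition monic :: "('o, 'a) category \<Rightarrow> 'a \<Rightarrow> bool" where
  "monic C m \<longleftrightarrow> m \<in> Arr C \<and>
     (\<forall>X. \<forall>f \<in> Hom C X (Dom C m). \<forall>g \<in> Hom C X (Dom C m).
        Comp C m f = Comp C m g \<longrightarrow> f = g)"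

definition is_coequaliser :: "('o, 'a) category \<Rightarrow> 'a \<Rightarrow> 'a \<Rightarrow> 'a \<Rightarrow> bool" where
  "is_coequaliser C f g e \<longleftrightarrow>
     (\<exists>X Y Q. f \<in> Hom C X Y \<and> g \<in> Hom C X Y \<and> e \<in> Hom C Y Q \<and>
        Comp C e f = Comp C e g \<and>
        (\<forall>Z. \<forall>h \<in> Hom C Y Z. Comp C h f = Comp C h g \<longrightarrow>
           (\<exists>!k. k \<in> Hom C Q Z \<and> Comp C k e = h)))"

definition regular_epic :: "('o, 'a) category \<Rightarrow> 'a \<Rightarrow> bool" where
  "regular_epic C e \<longleftrightarrow> (\<exists>f g. is_coequaliser C f g e)"

definition is_coproduct ::
    "('o, 'a) category \<Rightarrow> 'i set \<Rightarrow> ('i \<Rightarrow> 'o) \<Rightarrow> 'o \<Rightarrow> ('i \<Rightarrow> 'a) \<Rightarrow> bool" where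
  "is_coproduct C I X P \<iota> \<longleftrightarrow>
     P \<in> Obj C \<and> (\<forall>i \<in> I. \<iota> i \<in> Hom C (X i) P) \<and>
     (\<forall>Z \<in> Obj C. \<forall>k. (\<forall>i \<in> I. k i \<in> Hom C (X i) Z) \<longrightarrow>
        (\<exists>!m. m \<in> Hom C P Z \<and> (\<forall>i \<in> I. Comp C m (\<iota> i) = k i)))"

text \<open>
  The sum over \<open>G \<in> \<G>\<close> and \<open>h \<in> hom(G, A)\<close> is indexed by the pairs \<open>(G, h)\<close>.  All coproducts of
  the family are isomorphic, so it does not matter which one is taken; quantifying universally over
  them ensures that a set of objects cannot fail to be regularly generating merely because some
  coproduct does not exist.
\<close>

definition regularly_generating :: "('o, 'a) category \<Rightarrow> 'o set \<Rightarrow> bool" where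
  "regularly_generating C \<G> \<longleftrightarrow>
     \<G> \<subseteq> Obj C \<and>
     (\<forall>A \<in> Obj C. \<forall>P \<iota>.
        is_coproduct C (SIGMA G:\<G>. Hom C G A) fst P \<iota> \<longrightarrow>
        regular_epic C
          (THE m. m \<in> Hom C P A \<and> (\<forall>G \<in> \<G>. \<forall>h \<in> Hom C G A. Comp C m (\<iota> (G, h)) = h)))"

definition filtered :: "('i, 'j) category \<Rightarrow> bool" where
  "filtered J \<longleftrightarrow>
     is_category J \<and> Obj J \<noteq> {} \<and>
     (\<forall>i \<in> Obj J. \<forall>j \<in> Obj J. \<exists>k \<in> Obj J. Hom J i k \<noteq> {} \<and> Hom J j k \<noteq> {}) \<and>
     (\<forall>i j. \<forall>u \<in> Hom J i j. \<forall>v \<in> Hom J i j. \<exists>k. \<exists>w \<in> Hom J j k. Comp J w u = Comp J w v)"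

definition is_cocone ::
    "('o, 'a) category \<Rightarrow> ('i, 'j) category \<Rightarrow> ('i \<Rightarrow> 'o) \<Rightarrow> ('j \<Rightarrow> 'a) \<Rightarrow> 'o \<Rightarrow> ('i \<Rightarrow> 'a) \<Rightarrow> bool"
  where
  "is_cocone C J Fo Fa L c \<longleftrightarrow>
     L \<in> Obj C \<and> (\<forall>i \<in> Obj J. c i \<in> Hom C (Fo i) L) \<and>
     (\<forall>i j. \<forall>u \<in> Hom J i j. Comp C (c j) (Fa u) = c i)"

definition is_colimit ::
    "('o, 'a) category \<Rightarrow> ('i, 'j) category \<Rightarrow> ('i \<Rightarrow> 'o) \<Rightarrow> ('j \<Rightarrow> 'a) \<Rightarrow> 'o \<Rightarrow> ('i \<Rightarrow> 'a) \<Rightarrow> bool"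
  where
  "is_colimit C J Fo Fa L c \<longleftrightarrow>
     is_cocone C J Fo Fa L c \<and>
     (\<forall>Z d. is_cocone C J Fo Fa Z d \<longrightarrow>
        (\<exists>!m. m \<in> Hom C L Z \<and> (\<forall>i \<in> Obj J. Comp C m (c i) = d i)))"

text \<open>The functor \<open>(Ho, Ha)\<close> from \<open>C\<close> to \<open>D\<close> sends every colimit cocone of \<open>(Fo, Fa)\<close> to a colimit cocone.\<close>

definition preserves_colimits_of ::
    "('o, 'a) category \<Rightarrow> ('p, 'b) category \<Rightarrow> ('o \<Rightarrow> 'p) \<Rightarrow> ('a \<Rightarrow> 'b) \<Rightarrow>
     ('i, 'j) category \<Rightarrow> ('i \<Rightarrow> 'o) \<Rightarrow> ('j \<Rightarrow> 'a) \<Rightarrow> bool" where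
  "preserves_colimits_of C D Ho Ha J Fo Fa \<longleftrightarrow>
     (\<forall>L c. is_colimit C J Fo Fa L c \<longrightarrow>
        is_colimit D J (Ho \<circ> Fo) (Ha \<circ> Fa) (Ho L) (Ha \<circ> c))"

text \<open>
  Arrows of the concrete categories below are triples of domain, underlying function and codomain,
  the function being \<^const>\<open>undefined\<close> outside the domain (\<^const>\<open>extensional\<close>), so that equal
  arrows are equal triples.
\<close>

definition set_category :: "('x set, 'x set \<times> ('x \<Rightarrow> 'x) \<times> 'x set) category" where
  "set_category =
     \<lparr>Obj = UNIV,
      Arr = {(X, f, Y). f \<in> X \<rightarrow>\<^sub>E Y},
      Dom = (\<lambda>(X, f, Y). X),
      Cod = (\<lambda>(X, f, Y). Y),
      Id = (\<lambda>X. (X, restrict (\<lambda>x. x) X, X)),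
      Comp = (\<lambda>(Y, g, Z) (X, f, Y'). (X, compose X g f, Z))\<rparr>"

definition hom_functor_arr :: "('o, 'a) category \<Rightarrow> 'o \<Rightarrow> 'a \<Rightarrow> 'a set \<times> ('a \<Rightarrow> 'a) \<times> 'a set" where
  "hom_functor_arr C A f =
     (Hom C A (Dom C f), restrict (\<lambda>g. Comp C f g) (Hom C A (Dom C f)), Hom C A (Cod C f))"

text \<open>
  Sizes: the elements of a type \<open>'u\<close> serve as the universe, and a set is small if it has strictly
  fewer elements than \<open>'u\<close>.  If the cardinality of \<open>'u\<close> is inaccessible, these are, up to bijection,
  the elements of a Grothendieck universe of that cardinality.
\<close>

definition small :: "'u itself \<Rightarrow> 'x set \<Rightarrow> bool" where
  "small U S \<longleftrightarrow> S \<prec> (UNIV :: 'u set)"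

definition finitely_generated_object :: "'u itself \<Rightarrow> ('o, 'a) category \<Rightarrow> 'o \<Rightarrow> bool" where
  "finitely_generated_object U C A \<longleftrightarrow>
     A \<in> Obj C \<and>
     (\<forall>(J :: ('u, 'u) category) Fo Fa.
        small U (Obj J) \<and> small U (Arr J) \<and> filtered J \<and> is_functor J C Fo Fa \<and>
        (\<forall>u \<in> Arr J. monic C (Fa u)) \<longrightarrow>
        preserves_colimits_of C set_category (Hom C A) (hom_functor_arr C A) J Fo Fa)"


section \<open>MV-algebras\<close>

record 'u mv_algebra = "'u partial_object" +
  mv_plus :: "'u \<Rightarrow> 'u \<Rightarrow> 'u"  (infixl \<open>\<oplus>\<index>\<close> 65)
  mv_neg :: "'u \<Rightarrow> 'u"  (\<open>\<sim>\<index> _\<close> [80] 80)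
  mv_zero :: 'u  (\<open>\<zero>\<index>\<close>)

text \<open>
  MV-algebras are by definition commutative, and commutativity has to be required of the monoid: with
  the neutral element two-sided and \<open>\<not>0 \<oplus> x = \<not>0\<close> as the only absorption law, it does not follow from
  the other axioms.  (On \<open>{0, a, 1}\<close> let \<open>0\<close> be neutral, \<open>1 \<oplus> x = 1\<close>, \<open>a \<oplus> x = a\<close>, \<open>\<not>0 = 1\<close>,
  \<open>\<not>a = a\<close>, \<open>\<not>1 = 0\<close>.)
\<close>

definition is_mv_algebra :: "'u mv_algebra \<Rightarrow> bool" where
  "is_mv_algebra A \<longleftrightarrow>
     comm_monoid \<lparr>carrier = carrier A, mult = mv_plus A, one = mv_zero A\<rparr> \<and>
     (\<forall>x \<in> carrier A. \<sim>\<^bsub>A\<^esub> x \<in> carrier A) \<and>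
     (\<forall>x \<in> carrier A. \<sim>\<^bsub>A\<^esub> \<sim>\<^bsub>A\<^esub> x = x) \<and>
     (\<forall>x \<in> carrier A. \<sim>\<^bsub>A\<^esub> \<zero>\<^bsub>A\<^esub> \<oplus>\<^bsub>A\<^esub> x = \<sim>\<^bsub>A\<^esub> \<zero>\<^bsub>A\<^esub>) \<and>
     (\<forall>x \<in> carrier A. \<forall>y \<in> carrier A.
        \<sim>\<^bsub>A\<^esub> (\<sim>\<^bsub>A\<^esub> x \<oplus>\<^bsub>A\<^esub> y) \<oplus>\<^bsub>A\<^esub> y = \<sim>\<^bsub>A\<^esub> (\<sim>\<^bsub>A\<^esub> y \<oplus>\<^bsub>A\<^esub> x) \<oplus>\<^bsub>A\<^esub> x)"

definition mv_subuniverse :: "'u mv_algebra \<Rightarrow> 'u set \<Rightarrow> bool" where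
  "mv_subuniverse A S \<longleftrightarrow>
     S \<subseteq> carrier A \<and> \<zero>\<^bsub>A\<^esub> \<in> S \<and> (\<forall>x \<in> S. \<sim>\<^bsub>A\<^esub> x \<in> S) \<and> (\<forall>x \<in> S. \<forall>y \<in> S. x \<oplus>\<^bsub>A\<^esub> y \<in> S)"

definition mv_generated :: "'u mv_algebra \<Rightarrow> 'u set \<Rightarrow> 'u set" where
  "mv_generated A X = \<Inter> {S. mv_subuniverse A S \<and> X \<subseteq> S}"

definition locally_finite_mv :: "'u mv_algebra \<Rightarrow> bool" where
  "locally_finite_mv A \<longleftrightarrow> (\<forall>X \<subseteq> carrier A. finite X \<longrightarrow> finite (mv_generated A X))"

definition mv_hom :: "'u mv_algebra \<Rightarrow> 'u mv_algebra \<Rightarrow> ('u \<Rightarrow> 'u) set" where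
  "mv_hom A B = {f \<in> carrier A \<rightarrow>\<^sub>E carrier B.
     f \<zero>\<^bsub>A\<^esub> = \<zero>\<^bsub>B\<^esub> \<and>
     (\<forall>x \<in> carrier A. f (\<sim>\<^bsub>A\<^esub> x) = \<sim>\<^bsub>B\<^esub> f x) \<and>
     (\<forall>x \<in> carrier A. \<forall>y \<in> carrier A. f (x \<oplus>\<^bsub>A\<^esub> y) = f x \<oplus>\<^bsub>B\<^esub> f y)}"

type_synonym 'u mv_arrow = "'u mv_algebra \<times> ('u \<Rightarrow> 'u) \<times> 'u mv_algebra"

text \<open>The category of all (small) locally finite MV-algebras and all MV-homomorphisms between them.\<close>

definition MV_lf :: "'u itself \<Rightarrow> ('u mv_algebra, 'u mv_arrow) category" where
  "MV_lf U =
     (let Ob = {A. is_mv_algebra A \<and> locally_finite_mv A \<and> small U (carrier A)} in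
     \<lparr>Obj = Ob,
      Arr = {(A, f, B). A \<in> Ob \<and> B \<in> Ob \<and> f \<in> mv_hom A B},
      Dom = (\<lambda>(A, f, B). A),
      Cod = (\<lambda>(A, f, B). B),
      Id = (\<lambda>A. (A, restrict (\<lambda>x. x) (carrier A), A)),
      Comp = (\<lambda>(B, g, C) (A, f, B'). (A, compose (carrier A) g f, C))\<rparr>)"

lemma is_mv_algebraD:
  assumes "is_mv_algebra A"
  shows "\<zero>\<^bsub>A\<^esub> \<in> carrier A"
    and "x \<in> carrier A \<Longrightarrow> \<sim>\<^bsub>A\<^esub> x \<in> carrier A"
    and "x \<in> carrier A \<Longrightarrow> y \<in> carrier A \<Longrightarrow> x \<oplus>\<^bsub>A\<^esub> y \<in> carrier A"
  using assms comm_monoid.axioms(1) monoid.one_closed monoid.m_closed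
  unfolding is_mv_algebra_def by fastforce+

lemma is_category_set_category: "is_category set_category"
  unfolding is_category_def set_category_def Hom_def
  by (auto simp: compose_def PiE_iff extensional_def fun_eq_iff)

lemma is_category_MV_lf: "is_category (MV_lf U)"
  unfolding is_category_def MV_lf_def Hom_def Let_def
  by (auto simp: compose_def mv_hom_def PiE_iff extensional_def fun_eq_iff is_mv_algebraD)

lemma is_functor_hom:
  assumes "is_category C" and "A \<in> Obj C"
  shows "is_functor C set_category (Hom C A) (hom_functor_arr C A)"
proof -
  note C = assms(1)[unfolded is_category_def]
  have D: "Dom C (Id C X) = X" "Cod C (Id C X) = X" if "X \<in> Obj C" for X
    using C that by (auto simp: Hom_def)
  have E: "Comp C f g \<in> Hom C X Z" if "g \<in> Hom C X Y" "f \<in> Hom C Y Z" for f g X Y Z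
    using C that by blast
  have I: "Comp C (Id C Y) g = g" if "g \<in> Hom C X Y" for g X Y
    using C that by blast
  have As: "Comp C h (Comp C g f) = Comp C (Comp C h g) f"
    if "f \<in> Hom C W X" "g \<in> Hom C X Y" "h \<in> Hom C Y Z" for f g h W X Y Z
    using C that by blast
  have 1: "hom_functor_arr C A u \<in> Hom set_category (Hom C A X) (Hom C A Y)"
    if "u \<in> Hom C X Y" for u X Y
  proof -
    have "Dom C u = X" "Cod C u = Y" using that by (auto simp: Hom_def)
    then show ?thesis using E that
      by (auto simp: hom_functor_arr_def set_category_def Hom_def[where C = "category.make _ _ _ _ _ _", unfolded category.make_def])
  qed
  have 2: "hom_functor_arr C A (Id C X) = Id set_category (Hom C A X)" if "X \<in> Obj C" for X
    using D[OF that] I by (auto simp: hom_functor_arr_def set_category_def intro!: restrict_ext)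
  have 3: "hom_functor_arr C A (Comp C v u)
      = Comp set_category (hom_functor_arr C A v) (hom_functor_arr C A u)"
    if "u \<in> Hom C X Y" "v \<in> Hom C Y Z" for u v X Y Z
  proof -
    have "Dom C u = X" "Cod C u = Y" "Dom C v = Y" "Cod C v = Z"
      "Dom C (Comp C v u) = X" "Cod C (Comp C v u) = Z"
      using that E[OF that] by (auto simp: Hom_def)
    then show ?thesis using E As that
      by (auto simp: hom_functor_arr_def set_category_def compose_def intro!: restrict_ext)
  qed
  show ?thesis
    unfolding is_functor_def using assms(1) is_category_set_category 1 2 3
    by (auto simp: set_category_def)
qed

end

theory Submission
  imports Defs Complex_Main
begin

text \<open>
  A finitely generated object is finite: it is the filtered colimit of its finite subalgebras along
  inclusions, so its identity factors through one of them.  Let all members of the finite set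
  \<open>\<G>\<close> have at most \<open>M\<close> elements, let \<open>p = 2 M! + 1\<close>, and let \<open>A\<close> be the chain with \<open>p + 1\<close>
  elements.  A homomorphism from a member of \<open>\<G>\<close> to \<open>A\<close> has as image a chain with \<open>d + 1\<close> elements
  for some \<open>d < M\<close>, and as \<open>d\<close> is coprime to \<open>p\<close>, the image is \<open>{0, 1}\<close>.  Hence the canonical arrow
  to \<open>A\<close> factors through the inclusion of \<open>{0, 1}\<close>; if it were a coequaliser, it would yield a
  homomorphism from \<open>A\<close> to \<open>{0, 1}\<close>, which does not exist.

  The argument needs the coproduct of finitely many finite algebras to exist.  It is realised as a
  subalgebra of a finite power of a finite chain, which works because homomorphisms to \<open>[0, 1]\<close>
  separate the points of a finite MV-algebra.
\<close>

section \<open>Finite MV-algebras and atoms\<close>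

locale mv_alg =
  fixes A :: "'a mv_algebra" (structure)
  assumes mv: "is_mv_algebra A"
begin

text \<open>In the unit interval this is \<open>max 0 (x - y)\<close>. Join and meet are expressed
  through it, as \<open>minus x y \<oplus> y\<close> and \<open>minus x (minus x y)\<close>.\<close>

definition minus :: "'a \<Rightarrow> 'a \<Rightarrow> 'a" (infixl "\<^bold>-" 65)
  where "x \<^bold>- y = \<sim> (\<sim> x \<oplus> y)"

definition le :: "'a \<Rightarrow> 'a \<Rightarrow> bool" (infix "\<preceq>" 50)
  where "x \<preceq> y \<longleftrightarrow> x \<^bold>- y = \<zero>"

lemma zero_closed [simp]: "\<zero> \<in> carrier A"
  and neg_closed [simp]: "x \<in> carrier A \<Longrightarrow> \<sim> x \<in> carrier A"
  and plus_closed [simp]: "\<lbrakk>x \<in> carrier A; y \<in> carrier A\<rbrakk> \<Longrightarrow> x \<oplus> y \<in> carrier A"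
  using is_mv_algebraD[OF mv] by auto

lemma minus_closed [simp]: "\<lbrakk>x \<in> carrier A; y \<in> carrier A\<rbrakk> \<Longrightarrow> x \<^bold>- y \<in> carrier A"
  by (simp add: minus_def)

lemma neg_neg [simp]: "x \<in> carrier A \<Longrightarrow> \<sim> \<sim> x = x"
  and one_plus [simp]: "x \<in> carrier A \<Longrightarrow> \<sim> \<zero> \<oplus> x = \<sim> \<zero>"
  and sup_comm: "\<lbrakk>x \<in> carrier A; y \<in> carrier A\<rbrakk> \<Longrightarrow> x \<^bold>- y \<oplus> y = y \<^bold>- x \<oplus> x"
  using mv by (auto simp: is_mv_algebra_def minus_def)

lemma plus_assoc: "\<lbrakk>x \<in> carrier A; y \<in> carrier A; z \<in> carrier A\<rbrakk> \<Longrightarrow> x \<oplus> y \<oplus> z = x \<oplus> (y \<oplus> z)"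
  and plus_comm: "\<lbrakk>x \<in> carrier A; y \<in> carrier A\<rbrakk> \<Longrightarrow> x \<oplus> y = y \<oplus> x"
  and zero_plus [simp]: "x \<in> carrier A \<Longrightarrow> \<zero> \<oplus> x = x"
  and plus_zero [simp]: "x \<in> carrier A \<Longrightarrow> x \<oplus> \<zero> = x"
proof -
  interpret comm_monoid "\<lparr>carrier = carrier A, mult = mv_plus A, one = mv_zero A\<rparr>"
    using mv by (simp add: is_mv_algebra_def)
  show "\<lbrakk>x \<in> carrier A; y \<in> carrier A; z \<in> carrier A\<rbrakk> \<Longrightarrow> x \<oplus> y \<oplus> z = x \<oplus> (y \<oplus> z)"
    "\<lbrakk>x \<in> carrier A; y \<in> carrier A\<rbrakk> \<Longrightarrow> x \<oplus> y = y \<oplus> x"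
    "x \<in> carrier A \<Longrightarrow> \<zero> \<oplus> x = x" "x \<in> carrier A \<Longrightarrow> x \<oplus> \<zero> = x"
    using m_assoc m_comm l_one r_one by auto
qed

lemma plus_left_comm:
  "\<lbrakk>x \<in> carrier A; y \<in> carrier A; z \<in> carrier A\<rbrakk> \<Longrightarrow> x \<oplus> (y \<oplus> z) = y \<oplus> (x \<oplus> z)"
  by (metis plus_assoc plus_comm)

lemmas plus_ac = plus_assoc plus_comm plus_left_comm

lemma plus_one [simp]: "x \<in> carrier A \<Longrightarrow> x \<oplus> \<sim> \<zero> = \<sim> \<zero>"
  by (metis neg_closed one_plus plus_comm zero_closed)

text \<open>The law \<open>sup_comm\<close> with the top element for \<open>y\<close>: one side is
  absorbed to the top, and the top minus \<open>x\<close> is \<open>\<sim> x\<close>.\<close>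

lemma neg_plus [simp]: "x \<in> carrier A \<Longrightarrow> \<sim> x \<oplus> x = \<sim> \<zero>"
  using sup_comm[of x "\<sim> \<zero>"] by (simp add: minus_def)

lemma minus_zero [simp]: "x \<in> carrier A \<Longrightarrow> x \<^bold>- \<zero> = x"
  and zero_minus [simp]: "x \<in> carrier A \<Longrightarrow> \<zero> \<^bold>- x = \<zero>"
  and minus_self [simp]: "x \<in> carrier A \<Longrightarrow> x \<^bold>- x = \<zero>"
  by (simp_all add: minus_def)

lemma minus_minus:
  "\<lbrakk>x \<in> carrier A; y \<in> carrier A; z \<in> carrier A\<rbrakk> \<Longrightarrow> x \<^bold>- y \<^bold>- z = x \<^bold>- (y \<oplus> z)"
  by (simp add: minus_def plus_assoc)

lemma neg_minus: "\<lbrakk>x \<in> carrier A; y \<in> carrier A\<rbrakk> \<Longrightarrow> \<sim> x \<^bold>- y = \<sim> (x \<oplus> y)"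
  by (simp add: minus_def)

lemma neg_minus_neg: "\<lbrakk>x \<in> carrier A; y \<in> carrier A\<rbrakk> \<Longrightarrow> \<sim> y \<^bold>- \<sim> x = x \<^bold>- y"
  by (simp add: minus_def plus_comm)

text \<open>De Morgan dual of \<open>sup_comm\<close>: negation reverses differences and so turns
  joins into meets.\<close>

lemma inf_comm:
  assumes [simp]: "x \<in> carrier A" "y \<in> carrier A"
  shows "x \<^bold>- (x \<^bold>- y) = y \<^bold>- (y \<^bold>- x)"
  using sup_comm[of "\<sim> y" "\<sim> x"] by (simp add: neg_minus_neg) (simp add: minus_def plus_comm)

lemma le_refl [simp]: "x \<in> carrier A \<Longrightarrow> x \<preceq> x"
  and zero_le [simp]: "x \<in> carrier A \<Longrightarrow> \<zero> \<preceq> x"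
  by (simp_all add: le_def)

text \<open>Truncated subtraction is adjoint to addition; both inequalities unfold to the vanishing
  of the same iterated difference.\<close>

lemma residuation:
  "\<lbrakk>x \<in> carrier A; y \<in> carrier A; z \<in> carrier A\<rbrakk> \<Longrightarrow> x \<^bold>- y \<preceq> z \<longleftrightarrow> x \<preceq> y \<oplus> z"
  by (simp add: le_def minus_minus)

lemma le_plus: "\<lbrakk>x \<in> carrier A; y \<in> carrier A\<rbrakk> \<Longrightarrow> x \<preceq> x \<oplus> y"
  by (simp add: residuation[symmetric])

lemma minus_le: "\<lbrakk>x \<in> carrier A; y \<in> carrier A\<rbrakk> \<Longrightarrow> x \<^bold>- y \<preceq> x"
  by (metis residuation le_plus plus_comm)

text \<open>The left side is the join of \<open>x\<close> and \<open>y\<close>, and \<open>y\<close>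
  lies below \<open>x\<close>.\<close>

lemma minus_plus_cancel: "\<lbrakk>x \<in> carrier A; y \<in> carrier A; y \<preceq> x\<rbrakk> \<Longrightarrow> x \<^bold>- y \<oplus> y = x"
  using sup_comm[of x y] by (simp add: le_def)

text \<open>The premise \<open>y \<preceq> \<sim> x\<close> says that the sum is not truncated at
  the top. Negation reduces the claim to \<open>minus_plus_cancel\<close> for
  \<open>\<sim> x\<close>.\<close>

lemma plus_minus_cancel:
  assumes [simp]: "x \<in> carrier A" "y \<in> carrier A" and "y \<preceq> \<sim> x"
  shows "x \<oplus> y \<^bold>- y = x"
proof -
  have "\<sim> (\<sim> x \<^bold>- y \<oplus> y) = x"
    using assms by (simp add: minus_plus_cancel)
  then show ?thesis
    by (simp add: minus_def)
qed

lemma le_antisym: "\<lbrakk>x \<in> carrier A; y \<in> carrier A; x \<preceq> y; y \<preceq> x\<rbrakk> \<Longrightarrow> x = y"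
  using sup_comm[of x y] by (simp add: le_def)

text \<open>\<open>z\<close> is \<open>x\<close> plus the gaps from \<open>x\<close> to
  \<open>y\<close> and from \<open>y\<close> to \<open>z\<close>, so \<open>le_plus\<close>
  applies.\<close>

lemma le_trans:
  assumes [simp]: "x \<in> carrier A" "y \<in> carrier A" "z \<in> carrier A" and "x \<preceq> y" "y \<preceq> z"
  shows "x \<preceq> z"
proof -
  have "z = x \<oplus> ((y \<^bold>- x) \<oplus> (z \<^bold>- y))"
    using minus_plus_cancel[of y x] minus_plus_cancel[of z y] assms
    by (metis minus_closed plus_assoc plus_comm)
  then show ?thesis
    by (metis assms(1-3) le_plus minus_closed plus_closed)
qed

lemma le_neg_zero: "x \<in> carrier A \<Longrightarrow> x \<preceq> \<sim> \<zero>"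
  by (simp add: le_def minus_def)

lemma le_zero: "\<lbrakk>x \<in> carrier A; x \<preceq> \<zero>\<rbrakk> \<Longrightarrow> x = \<zero>"
  by (simp add: le_antisym)

text \<open>Provides a strictly monotone measure, used for induction and for picking minimal
  elements of a finite algebra.\<close>

lemma card_below_less:
  assumes "finite (carrier A)" "x \<in> carrier A" "y \<in> carrier A" "x \<preceq> y" "x \<noteq> y"
  shows "card {z \<in> carrier A. z \<preceq> x} < card {z \<in> carrier A. z \<preceq> y}"
proof (rule psubset_card_mono)
  have "{z \<in> carrier A. z \<preceq> x} \<subseteq> {z \<in> carrier A. z \<preceq> y}"
    using le_trans[of _ x y] assms(2-4) by simp blast
  moreover have "\<not> y \<preceq> x"
    using assms(2-5) le_antisym[of x y] by blast
  ultimately show "{z \<in> carrier A. z \<preceq> x} \<subset> {z \<in> carrier A. z \<preceq> y}"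
    using assms(3) le_refl[of y] by (metis (mono_tags, lifting) mem_Collect_eq psubsetI)
qed (use assms(1) in simp)

end

section \<open>Heights of elements with respect to an atom\<close>

locale mv_atom = mv_alg +
  fixes e
  assumes finite_carrier [simp]: "finite (carrier A)"
    and e_closed [simp]: "e \<in> carrier A"
    and e_nonzero: "e \<noteq> \<zero>"
    and e_minimal: "\<lbrakk>x \<in> carrier A; x \<preceq> e\<rbrakk> \<Longrightarrow> x = \<zero> \<or> x = e"
begin

text \<open>The difference of \<open>e\<close> and \<open>x\<close> lies below the atom, so it is
  \<open>\<zero>\<close> or \<open>e\<close>. Thus subtracting an element not above the atom leaves
  the atom intact.\<close>

lemma not_le_iff: "x \<in> carrier A \<Longrightarrow> \<not> e \<preceq> x \<longleftrightarrow> e \<^bold>- x = e"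
  using e_minimal[of "e \<^bold>- x"] e_nonzero minus_le[of e x] by (auto simp: le_def)

lemma not_le_plus:
  "\<lbrakk>x \<in> carrier A; y \<in> carrier A; \<not> e \<preceq> x; \<not> e \<preceq> y\<rbrakk> \<Longrightarrow> \<not> e \<preceq> x \<oplus> y"
  by (simp add: not_le_iff flip: minus_minus)

text \<open>Copies of \<open>e\<close> are removed from \<open>x\<close> one at a time for as long
  as \<open>e\<close> lies below what remains; the number of elements below it decreases. The
  premise \<open>e \<preceq> \<sim> x\<close> of the step says that adding \<open>e\<close> back is
  not truncated.\<close>

lemma atom_induct [consumes 1, case_names base step]:
  assumes "x \<in> carrier A"
    and "\<And>x. \<lbrakk>x \<in> carrier A; \<not> e \<preceq> x\<rbrakk> \<Longrightarrow> Q x"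
    and "\<And>x. \<lbrakk>x \<in> carrier A; e \<preceq> \<sim> x; Q x\<rbrakk> \<Longrightarrow> Q (x \<oplus> e)"
  shows "Q x"
  using assms(1)
proof (induction "card {y \<in> carrier A. y \<preceq> x}" arbitrary: x rule: less_induct)
  case (less x)
  note [simp] = \<open>x \<in> carrier A\<close>
  show ?case
  proof (cases "e \<preceq> x")
    case True
    have "e \<preceq> \<sim> (x \<^bold>- e)"
      by (simp add: minus_def le_plus plus_comm)
    \<comment> \<open>This is the meet of \<open>x\<close> and \<open>e\<close>. If subtracting
      \<open>e\<close> did not change \<open>x\<close>, the expression would be zero.\<close>
    have "x \<^bold>- (x \<^bold>- e) = e"
      using True inf_comm[of x e] by (simp add: le_def)
    then have "x \<^bold>- e \<noteq> x"
      using e_nonzero by auto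
    then have "Q (x \<^bold>- e)"
      by (intro less.hyps card_below_less) (auto intro: minus_le)
    with \<open>e \<preceq> \<sim> (x \<^bold>- e)\<close> have "Q (x \<^bold>- e \<oplus> e)"
      by (simp add: assms(3))
    then show ?thesis
      using True by (simp add: minus_plus_cancel)
  qed (simp add: assms(2))
qed

primrec iter :: "nat \<Rightarrow> 'a" where
  "iter 0 = \<zero>"
| "iter (Suc k) = e \<oplus> iter k"

lemma iter_closed [simp]: "iter k \<in> carrier A"
  by (induction k) auto

text \<open>
  The number of times the atom \<open>e\<close> can be subtracted.  In a product of finite chains an atom is
  supported on a single factor, and the height is the projection to this factor, scaled to integers.
\<close>

definition height :: "'a \<Rightarrow> nat" where
  "height x = (LEAST k. \<not> e \<preceq> x \<^bold>- iter k)"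

lemma height_eq_0: "\<lbrakk>x \<in> carrier A; \<not> e \<preceq> x\<rbrakk> \<Longrightarrow> height x = 0"
  by (simp add: height_def Least_eq_0)

text \<open>Makes the \<open>LEAST\<close> in \<open>height\<close> meaningful.\<close>

lemma ex_height: "x \<in> carrier A \<Longrightarrow> \<exists>k. \<not> e \<preceq> x \<^bold>- iter k"
proof (induction rule: atom_induct)
  case (base x)
  then show ?case by (intro exI[of _ 0]) simp
next
  case (step x)
  then obtain k where "\<not> e \<preceq> x \<^bold>- iter k" by blast
  then have "\<not> e \<preceq> x \<oplus> e \<^bold>- iter (Suc k)"
    using step by (simp flip: minus_minus add: plus_minus_cancel)
  then show ?case by blast
qed

text \<open>The added copy of \<open>e\<close> cancels the first one subtracted, which shifts the
  least index by one; index 0 fails because \<open>e\<close> is below the sum.\<close>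

lemma height_plus_atom:
  assumes "x \<in> carrier A" "e \<preceq> \<sim> x"
  shows "height (x \<oplus> e) = Suc (height x)"
proof -
  obtain k where "\<not> e \<preceq> x \<oplus> e \<^bold>- iter k"
    using ex_height assms by force
  moreover have "e \<preceq> x \<oplus> e \<^bold>- iter 0"
    using assms le_plus plus_comm by simp
  ultimately have "height (x \<oplus> e) = Suc (LEAST k. \<not> e \<preceq> x \<oplus> e \<^bold>- iter (Suc k))"
    unfolding height_def by (intro Least_Suc) auto
  then show ?thesis
    using assms by (simp add: height_def plus_minus_cancel flip: minus_minus)
qed

lemma height_pos: "\<lbrakk>x \<in> carrier A; e \<preceq> x\<rbrakk> \<Longrightarrow> height x > 0"
  using ex_height[of x] unfolding height_def
  by (metis (no_types, lifting) LeastI gr0I iter.simps(1) minus_zero)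

text \<open>Summands not above the atom are invisible to the height. The induction step has to show
  that adding \<open>r\<close> still leaves room for one more copy of \<open>e\<close>.\<close>

lemma height_plus_not_le:
  assumes "y \<in> carrier A" and r: "r \<in> carrier A" "\<not> e \<preceq> r"
  shows "height (y \<oplus> r) = height y"
  using assms(1)
proof (induction rule: atom_induct)
  case (base y)
  with r show ?case by (simp add: height_eq_0 not_le_plus)
next
  case (step y)
  \<comment> \<open>Subtracting \<open>r\<close> preserves \<open>e \<preceq> \<sim> y\<close>: the
    subtrahends combine to the join of \<open>r\<close> and \<open>\<sim> y\<close>, which is above
    \<open>e\<close>. As subtracting \<open>r\<close> does not change \<open>e\<close>, it follows
    that \<open>e\<close> is below \<open>\<sim> (y \<oplus> r)\<close>.\<close>
  have "e \<^bold>- r \<^bold>- (\<sim> y \<^bold>- r) = \<zero>"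
  proof -
    have "e \<^bold>- r \<^bold>- (\<sim> y \<^bold>- r) = e \<^bold>- (\<sim> y \<^bold>- r \<oplus> r)"
      using step r by (simp add: minus_minus plus_comm)
    also have "\<dots> = e \<^bold>- (r \<^bold>- \<sim> y) \<^bold>- \<sim> y"
      using step r by (simp add: minus_minus sup_comm)
    also have "\<dots> = e \<^bold>- \<sim> y \<^bold>- (r \<^bold>- \<sim> y)"
      using step r by (simp add: minus_minus plus_comm)
    finally show ?thesis
      using step r by (simp add: le_def)
  qed
  then have "e \<preceq> \<sim> (y \<oplus> r)"
    using step r not_le_iff[of r] by (simp add: le_def neg_minus)
  then have "height (y \<oplus> r \<oplus> e) = Suc (height (y \<oplus> r))"
    using step r by (intro height_plus_atom) auto
  moreover have "y \<oplus> r \<oplus> e = y \<oplus> e \<oplus> r"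
    using step r by (simp add: plus_ac)
  ultimately show ?case
    using step by (simp add: height_plus_atom)
qed

text \<open>In the step, one copy of \<open>e\<close> moves from \<open>\<sim> y\<close> to
  \<open>y\<close>, so the total is unchanged. In the base case \<open>\<sim> y \<oplus> y\<close>
  is the top, and \<open>y\<close> adds no height.\<close>

lemma height_neg: "y \<in> carrier A \<Longrightarrow> height y + height (\<sim> y) = height (\<sim> \<zero>)"
proof (induction rule: atom_induct)
  case (base y)
  then show ?case
    using height_plus_not_le[of "\<sim> y" y] by (simp add: height_eq_0)
next
  case (step y)
  have "\<sim> (y \<oplus> e) \<oplus> e = \<sim> y"
    using minus_plus_cancel[of "\<sim> y" e] step by (simp add: neg_minus)
  moreover have "e \<preceq> \<sim> \<sim> (y \<oplus> e)"
    using step le_plus[of e y] by (simp add: plus_comm)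
  ultimately show ?case
    using height_plus_atom[of "\<sim> (y \<oplus> e)"] height_plus_atom[of y] step by simp
qed

text \<open>Either there is room for another \<open>e\<close> and both sides grow by one, or
  \<open>\<sim> (x \<oplus> y)\<close> has height zero and by \<open>height_neg\<close> both sides
  are already at the maximum. Divided by the height of the top, \<open>height\<close> thus becomes a
  homomorphism to the unit interval.\<close>

lemma height_plus:
  assumes "x \<in> carrier A" "y \<in> carrier A"
  shows "height (x \<oplus> y) = min (height (\<sim> \<zero>)) (height x + height y)"
  using assms(2)
proof (induction rule: atom_induct)
  case (base y)
  then show ?case
    using height_neg[of x] assms(1) by (simp add: height_plus_not_le height_eq_0)
next
  case (step y)
  have eq: "x \<oplus> (y \<oplus> e) = x \<oplus> y \<oplus> e"
    using assms(1) step by (simp add: plus_assoc)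
  show ?case
  proof (cases "e \<preceq> \<sim> (x \<oplus> y)")
    case True
    then have "height (\<sim> (x \<oplus> y)) > 0"
      using assms(1) step by (intro height_pos) auto
    then have "height (x \<oplus> y) < height (\<sim> \<zero>)"
      using height_neg[of "x \<oplus> y"] assms(1) step by simp
    then show ?thesis
      using True step assms(1) unfolding eq by (simp add: height_plus_atom)
  next
    case False
    then have *: "height (x \<oplus> y) = height (\<sim> \<zero>)"
      using height_neg[of "x \<oplus> y"] height_eq_0[of "\<sim> (x \<oplus> y)"] assms(1) step by simp
    have "\<not> e \<preceq> \<sim> (x \<oplus> y \<oplus> e)"
      using False le_trans[of e "\<sim> (x \<oplus> y) \<^bold>- e" "\<sim> (x \<oplus> y)"] minus_le[of "\<sim> (x \<oplus> y)" e]
        assms(1) step by (auto simp: neg_minus)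
    then have "height (x \<oplus> y \<oplus> e) = height (\<sim> \<zero>)"
      using height_neg[of "x \<oplus> y \<oplus> e"] height_eq_0[of "\<sim> (x \<oplus> y \<oplus> e)"] assms(1) step by simp
    then show ?thesis
      using * step unfolding eq by (simp add: height_plus_atom)
  qed
qed

end

text \<open>Among the nonzero elements below \<open>a\<close>, one with the fewest elements below it
  is an atom.\<close>

lemma (in mv_alg) ex_atom:
  assumes "finite (carrier A)" "a \<in> carrier A" "a \<noteq> \<zero>"
  obtains e where "mv_atom A e" "e \<preceq> a"
proof -
  define h where "h x = card {y \<in> carrier A. y \<preceq> x}" for x
  have "finite {x \<in> carrier A. x \<noteq> \<zero> \<and> x \<preceq> a}" "a \<in> {x \<in> carrier A. x \<noteq> \<zero> \<and> x \<preceq> a}"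
    using assms by auto
  then obtain e where e: "is_arg_min h (\<lambda>x. x \<in> {x \<in> carrier A. x \<noteq> \<zero> \<and> x \<preceq> a}) e"
    using ex_is_arg_min_if_finite[of "{x \<in> carrier A. x \<noteq> \<zero> \<and> x \<preceq> a}" h] by blast
  then have [simp]: "e \<in> carrier A" and "e \<noteq> \<zero>" "e \<preceq> a"
    by (simp_all add: is_arg_min_def)
  have "x = e" if "x \<in> carrier A" "x \<preceq> e" "x \<noteq> \<zero>" for x
  proof (rule ccontr)
    assume "x \<noteq> e"
    then have "h x < h e"
      unfolding h_def using assms(1) that \<open>e \<in> carrier A\<close> by (intro card_below_less)
    moreover have "x \<preceq> a"
      using that \<open>e \<preceq> a\<close> assms le_trans[of x e a] by simp
    ultimately show False
      using e that unfolding is_arg_min_def by blast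
  qed
  then have "mv_atom A e"
    using assms(1) \<open>e \<noteq> \<zero>\<close> \<open>e \<in> carrier A\<close>
    unfolding mv_atom_def mv_atom_axioms_def by (metis mv_alg_axioms)
  then show ?thesis
    using that \<open>e \<preceq> a\<close> by blast
qed

section \<open>Homomorphisms and subalgebras of the unit interval\<close>

text \<open>Unlike \<open>mv_hom\<close>, this allows algebras over different types and leaves
  values outside the carrier free, so composites need no restriction.\<close>

definition mv_morphism :: "'a mv_algebra \<Rightarrow> 'b mv_algebra \<Rightarrow> ('a \<Rightarrow> 'b) \<Rightarrow> bool" where
  "mv_morphism A B f \<longleftrightarrow> f \<in> carrier A \<rightarrow> carrier B \<and> f \<zero>\<^bsub>A\<^esub> = \<zero>\<^bsub>B\<^esub> \<and>
     (\<forall>x \<in> carrier A. f (\<sim>\<^bsub>A\<^esub> x) = \<sim>\<^bsub>B\<^esub> f x) \<and>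
     (\<forall>x \<in> carrier A. \<forall>y \<in> carrier A. f (x \<oplus>\<^bsub>A\<^esub> y) = f x \<oplus>\<^bsub>B\<^esub> f y)"

lemma mv_hom_iff: "f \<in> mv_hom A B \<longleftrightarrow> mv_morphism A B f \<and> f \<in> extensional (carrier A)"
  by (auto simp: mv_hom_def mv_morphism_def PiE_iff)

lemma mv_morphismD:
  assumes "mv_morphism A B f"
  shows "x \<in> carrier A \<Longrightarrow> f x \<in> carrier B"
    and "f \<zero>\<^bsub>A\<^esub> = \<zero>\<^bsub>B\<^esub>"
    and "x \<in> carrier A \<Longrightarrow> f (\<sim>\<^bsub>A\<^esub> x) = \<sim>\<^bsub>B\<^esub> f x"
    and "\<lbrakk>x \<in> carrier A; y \<in> carrier A\<rbrakk> \<Longrightarrow> f (x \<oplus>\<^bsub>A\<^esub> y) = f x \<oplus>\<^bsub>B\<^esub> f y"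
  using assms by (auto simp: mv_morphism_def)

lemma mv_morphism_comp:
  assumes "mv_morphism A B f" "mv_morphism B C g"
  shows "mv_morphism A C (\<lambda>x. g (f x))"
  using assms by (auto simp: mv_morphism_def Pi_iff)

lemma mv_morphism_cong:
  assumes "is_mv_algebra A" "mv_morphism A B f" "\<And>x. x \<in> carrier A \<Longrightarrow> g x = f x"
  shows "mv_morphism A B g"
  using assms(2,3) is_mv_algebraD[OF assms(1)] by (auto simp: mv_morphism_def)

section \<open>Subuniverses and generated subalgebras\<close>

lemma mv_subuniverseD:
  assumes "mv_subuniverse A S"
  shows "S \<subseteq> carrier A" and "x \<in> S \<Longrightarrow> x \<in> carrier A" and "\<zero>\<^bsub>A\<^esub> \<in> S"
    and "x \<in> S \<Longrightarrow> \<sim>\<^bsub>A\<^esub> x \<in> S" and "\<lbrakk>x \<in> S; y \<in> S\<rbrakk> \<Longrightarrow> x \<oplus>\<^bsub>A\<^esub> y \<in> S"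
  using assms by (auto simp: mv_subuniverse_def)

lemma is_mv_algebra_subuniverse:
  assumes "is_mv_algebra A" "mv_subuniverse A S"
  shows "is_mv_algebra (A\<lparr>carrier := S\<rparr>)"
proof -
  interpret mv_alg A by unfold_locales fact
  note S = mv_subuniverseD[OF assms(2)]
  have "comm_monoid \<lparr>carrier = S, mult = mv_plus A, one = mv_zero A\<rparr>"
    by unfold_locales (auto simp: S plus_ac)
  then show ?thesis
    using S(2-5) sup_comm by (auto simp: is_mv_algebra_def minus_def)
qed

lemma mv_subuniverse_carrier: "is_mv_algebra A \<Longrightarrow> mv_subuniverse A (carrier A)"
  using is_mv_algebraD[of A] by (auto simp: mv_subuniverse_def)

lemma mv_generated_superset: "X \<subseteq> mv_generated A X"
  by (auto simp: mv_generated_def)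

lemma mv_generated_least: "\<lbrakk>mv_subuniverse A S; X \<subseteq> S\<rbrakk> \<Longrightarrow> mv_generated A X \<subseteq> S"
  by (auto simp: mv_generated_def)

lemma mv_subuniverse_generated:
  assumes "is_mv_algebra A" "X \<subseteq> carrier A"
  shows "mv_subuniverse A (mv_generated A X)"
proof -
  have "mv_generated A X \<subseteq> carrier A"
    using mv_subuniverse_carrier[OF assms(1)] assms(2) by (rule mv_generated_least)
  then show ?thesis
    unfolding mv_subuniverse_def[of A "mv_generated A X"]
    by (auto simp: mv_generated_def intro: mv_subuniverseD)
qed

text \<open>The set where two homomorphisms agree is a subuniverse.\<close>

lemma mv_morphism_eq_on_generated:
  assumes "is_mv_algebra A" "X \<subseteq> carrier A" "mv_morphism A B f" "mv_morphism A B g"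
    and "\<And>x. x \<in> X \<Longrightarrow> f x = g x" and "x \<in> mv_generated A X"
  shows "f x = g x"
proof -
  have "mv_subuniverse A {x \<in> carrier A. f x = g x}"
    using assms(3,4) is_mv_algebraD[OF assms(1)] by (auto simp: mv_subuniverse_def mv_morphism_def)
  then have "mv_generated A X \<subseteq> {x \<in> carrier A. f x = g x}"
    using assms(2,5) by (intro mv_generated_least) auto
  with assms(6) show ?thesis by blast
qed

lemma mv_subuniverse_image:
  assumes "is_mv_algebra A" "mv_morphism A B f"
  shows "mv_subuniverse B (f ` carrier A)"
  unfolding mv_subuniverse_def
proof (intro conjI ballI)
  note f = mv_morphismD[OF assms(2)] and A = is_mv_algebraD[OF assms(1)]
  show "f ` carrier A \<subseteq> carrier B" using f(1) by blast
  show "\<zero>\<^bsub>B\<^esub> \<in> f ` carrier A" using imageI[OF A(1), of f] by (simp add: f(2))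
  fix x assume "x \<in> f ` carrier A"
  then obtain a where a: "x = f a" "a \<in> carrier A" by blast
  show "\<sim>\<^bsub>B\<^esub> x \<in> f ` carrier A"
    using imageI[OF A(2)[OF a(2)], of f] a by (simp add: f(3))
  fix y assume "y \<in> f ` carrier A"
  then obtain b where b: "y = f b" "b \<in> carrier A" by blast
  show "x \<oplus>\<^bsub>B\<^esub> y \<in> f ` carrier A"
    using imageI[OF A(3)[OF a(2) b(2)], of f] a b by (simp add: f(4))
qed

section \<open>The unit interval and its finite subalgebras\<close>

definition real_mv :: "real set \<Rightarrow> real mv_algebra" where
  "real_mv S = \<lparr>carrier = S, mv_plus = (\<lambda>x y. min 1 (x + y)), mv_neg = (\<lambda>x. 1 - x), mv_zero = 0\<rparr>"

lemma real_mv_simps [simp]: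
  "carrier (real_mv S) = S" "mv_plus (real_mv S) x y = min 1 (x + y)"
  "mv_neg (real_mv S) x = 1 - x" "mv_zero (real_mv S) = 0"
  by (simp_all add: real_mv_def)

abbreviation unit_mv :: "real mv_algebra" where
  "unit_mv \<equiv> real_mv {0..1}"

lemma is_mv_algebra_real_mv:
  assumes "mv_subuniverse unit_mv S"
  shows "is_mv_algebra (real_mv S)"
proof -
  have "comm_monoid \<lparr>carrier = {0..1::real}, mult = (\<lambda>x y. min 1 (x + y)), one = 0\<rparr>"
    by unfold_locales auto
  then have "is_mv_algebra unit_mv"
    by (auto simp: is_mv_algebra_def real_mv_def min_def)
  from is_mv_algebra_subuniverse[OF this assms] show ?thesis
    by (simp add: real_mv_def)
qed

text \<open>The finite Lukasiewicz chain with \<open>n + 1\<close> elements when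
  \<open>n > 0\<close>; for \<open>n = 0\<close>, division by zero collapses it to
  \<open>{0}\<close>.\<close>

definition rational_chain :: "nat \<Rightarrow> real set" where
  "rational_chain n = (\<lambda>k. real k / real n) ` {..n}"

lemma finite_rational_chain [simp]: "finite (rational_chain n)"
  by (simp add: rational_chain_def)

lemma mv_subuniverse_rational_chain:
  assumes "n > 0"
  shows "mv_subuniverse unit_mv (rational_chain n)"
  unfolding mv_subuniverse_def
proof (intro conjI ballI)
  show "rational_chain n \<subseteq> carrier unit_mv"
    using assms by (auto simp: rational_chain_def)
  show "\<zero>\<^bsub>unit_mv\<^esub> \<in> rational_chain n"
    by (auto simp: rational_chain_def intro!: image_eqI[of _ _ 0])
  fix x assume "x \<in> rational_chain n"
  then obtain j where j: "j \<le> n" "x = real j / real n"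
    by (auto simp: rational_chain_def)
  show "\<sim>\<^bsub>unit_mv\<^esub> x \<in> rational_chain n"
    unfolding rational_chain_def using assms j
    by (intro image_eqI[of _ _ "n - j"]) (auto simp: field_simps of_nat_diff)
  fix y assume "y \<in> rational_chain n"
  then obtain k where k: "k \<le> n" "y = real k / real n"
    by (auto simp: rational_chain_def)
  show "x \<oplus>\<^bsub>unit_mv\<^esub> y \<in> rational_chain n"
    unfolding rational_chain_def
  proof (rule image_eqI)
    have "x + y = real (j + k) / real n"
      using j k by (simp add: add_divide_distrib)
    then show "x \<oplus>\<^bsub>unit_mv\<^esub> y = real (min n (j + k)) / real n"
      using assms by (auto simp: min_def)
  qed simp
qed

lemma rational_chain_mono:
  assumes "m dvd n" "n > 0"
  shows "rational_chain m \<subseteq> rational_chain n"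
proof -
  obtain c where c: "n = m * c" using assms(1) by blast
  have "real k / real m \<in> rational_chain n" if "k \<le> m" for k
    unfolding rational_chain_def using that c assms(2)
    by (intro image_eqI[of _ _ "k * c"]) (auto simp: field_simps)
  then show ?thesis by (auto simp: rational_chain_def)
qed

text \<open>The least positive element of \<open>H\<close> is \<open>1 / d\<close>, and
  \<open>H\<close> consists of its multiples. The bound \<open>d < card H\<close> is what later
  makes \<open>d\<close> a divisor of a fixed factorial.\<close>

lemma finite_subuniverse_unit_mv:
  assumes H: "mv_subuniverse unit_mv H" and fin: "finite H"
  obtains d where "0 < d" "d < card H" "H \<subseteq> rational_chain d"
proof -
  have range: "0 \<le> x" "x \<le> 1" if "x \<in> H" for x
    using that H by (auto simp: mv_subuniverse_def)
  have neg: "1 - x \<in> H" if "x \<in> H" for x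
    using that H by (auto simp: mv_subuniverse_def)
  have plus: "min 1 (x + y) \<in> H" if "x \<in> H" "y \<in> H" for x y
    using that H by (auto simp: mv_subuniverse_def)
  have "0 \<in> H" using H by (auto simp: mv_subuniverse_def)
  then have "1 \<in> H" using neg by force
  have diff: "y - x \<in> H" if "x \<in> H" "y \<in> H" "x \<le> y" for x y
  proof -
    have "1 - min 1 ((1 - y) + x) \<in> H" using that by (intro neg plus)
    then show ?thesis using that by simp
  qed
  define e where "e = Min {x \<in> H. x > 0}"
  have "e \<in> {x \<in> H. x > 0}"
    unfolding e_def using fin \<open>1 \<in> H\<close> by (intro Min_in) auto
  then have e: "e \<in> H" "e > 0" by auto
  have e_le: "e \<le> x" if "x \<in> H" "x > 0" for x
    unfolding e_def using fin that by (intro Min_le) auto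
  have mult: "\<exists>k. x = real k * e" if "x \<in> H" for x
  proof -
    \<comment> \<open>Division with remainder by \<open>e\<close>: the remainder stays in
      \<open>H\<close> and is smaller than \<open>e\<close>, hence zero.\<close>
    define k where "k = nat \<lfloor>x / e\<rfloor>"
    have k: "real k * e \<le> x" "x < real k * e + e"
    proof -
      have "real k = of_int \<lfloor>x / e\<rfloor>"
        using range[OF that] e(2) by (simp add: k_def)
      then have "real k \<le> x / e" "x / e < real k + 1"
        using floor_correct[of "x / e"] by simp_all
      then show "real k * e \<le> x" "x < real k * e + e"
        using e(2) by (simp_all add: field_simps)
    qed
    have "x - real j * e \<in> H" if "j \<le> k" for j
      using that
    proof (induction j)
      case (Suc j)
      have "real (Suc j) * e \<le> real k * e"
        using Suc.prems e(2) by (intro mult_right_mono) auto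
      then have "x - real j * e - e \<in> H"
        using Suc e(1) k(1) by (intro diff[OF e(1)]) (auto simp: algebra_simps)
      then show ?case by (simp add: algebra_simps)
    qed (use \<open>x \<in> H\<close> in simp)
    then have "x - real k * e \<in> H" by blast
    with e_le[OF this] k show ?thesis by force
  qed
  obtain d where d: "1 = real d * e" using mult \<open>1 \<in> H\<close> by blast
  then have "d > 0" by (cases d) auto
  with d have e_eq: "e = 1 / real d" by (simp add: field_simps)
  \<comment> \<open>Conversely, all multiples of \<open>e\<close> up to 1 lie in \<open>H\<close>;
    these \<open>d + 1\<close> elements give \<open>d < card H\<close>.\<close>
  have "real j / real d \<in> H" if "j \<le> d" for j
    using that
  proof (induction j)
    case (Suc j)
    then have "min 1 (real j / real d + e) \<in> H" using e by (intro plus) auto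
    moreover have "real j / real d + e = real (Suc j) / real d"
      unfolding e_eq by (simp add: add_divide_distrib)
    moreover have "real (Suc j) / real d \<le> 1"
      using Suc.prems \<open>d > 0\<close> by simp
    ultimately show ?case by (simp add: min_absorb2)
  qed (use \<open>0 \<in> H\<close> in simp)
  then have "rational_chain d \<subseteq> H" by (auto simp: rational_chain_def)
  moreover have "card (rational_chain d) = Suc d"
    unfolding rational_chain_def using \<open>d > 0\<close> by (subst card_image) (auto simp: inj_on_def)
  ultimately have "d < card H"
    using card_mono[OF fin] by (metis Suc_le_eq)
  moreover have "x \<in> rational_chain d" if x: "x \<in> H" for x
  proof -
    obtain k where k: "x = real k * e" using mult x by blast
    then have "x = real k / real d" by (simp add: e_eq)
    moreover from this have "k \<le> d" using range(2)[OF x] \<open>d > 0\<close> by simp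
    ultimately show ?thesis by (auto simp: rational_chain_def)
  qed
  ultimately show ?thesis using that \<open>d > 0\<close> by blast
qed

text \<open>The denominator \<open>d\<close> depends on \<open>f\<close>, but being positive and
  below \<open>M\<close> it divides \<open>fact M\<close>. So one chain can receive all
  homomorphisms from algebras with at most \<open>M\<close> elements.\<close>

lemma mv_morphism_into_rational_chain:
  assumes "is_mv_algebra A" "finite (carrier A)" "card (carrier A) \<le> M" "mv_morphism A unit_mv f"
  obtains d where "0 < d" "d < M" "f ` carrier A \<subseteq> rational_chain d"
proof -
  obtain d where "0 < d" "d < card (f ` carrier A)" "f ` carrier A \<subseteq> rational_chain d"
    using finite_subuniverse_unit_mv[OF mv_subuniverse_image[OF assms(1,4)]] assms(2) by blast
  with that card_image_le[OF assms(2), of f] assms(3) show ?thesis by force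
qed

text \<open>The height at an atom below \<open>a\<close>, divided by the height of the top, is a
  homomorphism that is positive at \<open>a\<close>.\<close>

lemma finite_mv_algebra_separating:
  assumes "is_mv_algebra A" "finite (carrier A)" "a \<in> carrier A" "a \<noteq> \<zero>\<^bsub>A\<^esub>"
  obtains \<phi> where "mv_morphism A unit_mv \<phi>" "\<phi> a \<noteq> 0"
proof -
  interpret mv_alg A by unfold_locales fact
  obtain e where e: "mv_atom A e" "le e a"
    using ex_atom assms(2-4) by blast
  interpret mv_atom A e by fact
  define n where "n = height (mv_neg A (mv_zero A))"
  define \<phi> where "\<phi> x = real (height x) / real n" for x
  have "n > 0"
    unfolding n_def by (intro height_pos) (auto intro: le_neg_zero)
  have neg: "height x + height (mv_neg A x) = n" if "x \<in> carrier A" for x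
    using height_neg[OF that] by (simp add: n_def)
  have "height (mv_zero A) = 0"
    using e_nonzero le_zero by (intro height_eq_0) auto
  then have "mv_morphism A unit_mv \<phi>"
    unfolding mv_morphism_def \<phi>_def
  proof (intro conjI ballI)
    show "(\<lambda>x. real (height x) / real n) \<in> carrier A \<rightarrow> carrier unit_mv"
      using neg \<open>n > 0\<close> by (fastforce simp: field_simps)
    fix x assume x: "x \<in> carrier A"
    show "real (height (mv_neg A x)) / real n = mv_neg unit_mv (real (height x) / real n)"
      using neg[OF x] \<open>n > 0\<close> by (simp add: field_simps flip: of_nat_add)
    fix y assume y: "y \<in> carrier A"
    show "real (height (mv_plus A x y)) / real n
      = mv_plus unit_mv (real (height x) / real n) (real (height y) / real n)"
      using height_plus[OF x y] \<open>n > 0\<close>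
      by (auto simp: n_def min_def field_simps simp flip: of_nat_add)
  qed auto
  moreover have "\<phi> a \<noteq> 0"
    using height_pos[OF assms(3) e(2)] \<open>n > 0\<close> by (simp add: \<phi>_def)
  ultimately show ?thesis using that by blast
qed

section \<open>Finite coproducts\<close>

definition mv_power :: "'b mv_algebra \<Rightarrow> 't set \<Rightarrow> ('t \<Rightarrow> 'b) mv_algebra" where
  "mv_power B T =
     \<lparr>carrier = T \<rightarrow>\<^sub>E carrier B,
      mv_plus = (\<lambda>f g. \<lambda>t\<in>T. f t \<oplus>\<^bsub>B\<^esub> g t),
      mv_neg = (\<lambda>f. \<lambda>t\<in>T. \<sim>\<^bsub>B\<^esub> f t),
      mv_zero = (\<lambda>t\<in>T. \<zero>\<^bsub>B\<^esub>)\<rparr>"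

lemma is_mv_algebra_power:
  assumes "is_mv_algebra B"
  shows "is_mv_algebra (mv_power B T)"
proof -
  interpret mv_alg B by unfold_locales fact
  have "comm_monoid \<lparr>carrier = T \<rightarrow>\<^sub>E carrier B, mult = (\<lambda>f g. \<lambda>t\<in>T. mv_plus B (f t) (g t)),
    one = (\<lambda>t\<in>T. mv_zero B)\<rparr>"
    by unfold_locales (auto simp: PiE_iff extensional_def fun_eq_iff plus_ac)
  then show ?thesis
    using sup_comm by (auto simp: is_mv_algebra_def mv_power_def minus_def PiE_iff extensional_def
        fun_eq_iff)
qed

lemma mv_morphism_power_tuple:
  assumes "is_mv_algebra A" "\<And>t. t \<in> T \<Longrightarrow> mv_morphism A B (h t)"
  shows "mv_morphism A (mv_power B T) (\<lambda>x. \<lambda>t\<in>T. h t x)"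
  using assms(2) is_mv_algebraD[OF assms(1)]
  by (auto simp: mv_morphism_def mv_power_def fun_eq_iff Pi_iff)

text \<open>As soon as it is single-valued, this is the graph of a homomorphism extending \<open>X\<close>.\<close>

inductive mv_link :: "'a mv_algebra \<Rightarrow> 'b mv_algebra \<Rightarrow> ('a \<times> 'b) set \<Rightarrow> 'a \<Rightarrow> 'b \<Rightarrow> bool"
  for A B X where
  base: "(x, y) \<in> X \<Longrightarrow> mv_link A B X x y"
| zero: "mv_link A B X \<zero>\<^bsub>A\<^esub> \<zero>\<^bsub>B\<^esub>"
| neg: "mv_link A B X x y \<Longrightarrow> mv_link A B X (\<sim>\<^bsub>A\<^esub> x) (\<sim>\<^bsub>B\<^esub> y)"
| plus: "mv_link A B X x y \<Longrightarrow> mv_link A B X x' y' \<Longrightarrow> mv_link A B X (x \<oplus>\<^bsub>A\<^esub> x') (y \<oplus>\<^bsub>B\<^esub> y')"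

lemma mv_link_closed:
  assumes "mv_link A B X x y" "mv_subuniverse A S" "mv_subuniverse B S'" "X \<subseteq> S \<times> S'"
  shows "x \<in> S \<and> y \<in> S'"
  using assms(1)
  by induction (use assms(2-4) in \<open>auto simp: mv_subuniverse_def\<close>)

text \<open>Only the values linked to zero need control: if \<open>y\<close> and \<open>y'\<close>
  are linked to the same \<open>x\<close>, both of their differences are linked to
  \<open>\<zero>\<close> and vanish, so antisymmetry gives \<open>y = y'\<close>.\<close>

lemma mv_link_extension:
  assumes A: "is_mv_algebra A" and B: "is_mv_algebra B" and X: "X \<subseteq> carrier A \<times> carrier B"
    and gen: "carrier A = mv_generated A (fst ` X)"
    and zero: "\<And>y. mv_link A B X \<zero>\<^bsub>A\<^esub> y \<Longrightarrow> y = \<zero>\<^bsub>B\<^esub>"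
  obtains m where "mv_morphism A B m" "\<And>x y. (x, y) \<in> X \<Longrightarrow> m x = y"
proof -
  interpret A: mv_alg A by unfold_locales fact
  interpret B: mv_alg B by unfold_locales fact
  note closed = mv_link_closed[OF _ mv_subuniverse_carrier[OF A] mv_subuniverse_carrier[OF B] X]
  \<comment> \<open>The domain of the relation is a subuniverse containing the generators.\<close>
  have total: "\<exists>y. mv_link A B X x y" if "x \<in> carrier A" for x
  proof -
    have "mv_subuniverse A {x. \<exists>y. mv_link A B X x y}"
      unfolding mv_subuniverse_def using closed
      by (auto intro: mv_link.intros)
    then have "mv_generated A (fst ` X) \<subseteq> {x. \<exists>y. mv_link A B X x y}"
      by (rule mv_generated_least) (auto intro!: exI mv_link.base)
    with that gen show ?thesis by blast
  qed
  have minus_zero: "B.minus y y' = mv_zero B" if "mv_link A B X x y" "mv_link A B X x y'" for x y y'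
  proof -
    have "mv_link A B X (A.minus x x) (B.minus y y')"
      unfolding A.minus_def B.minus_def using that by (auto intro: mv_link.intros)
    with closed[OF that(1)] show ?thesis by (auto intro: zero)
  qed
  have unique: "y = y'" if "mv_link A B X x y" "mv_link A B X x y'" for x y y'
    using minus_zero[OF that] minus_zero[OF that(2,1)] closed that
    by (intro B.le_antisym) (auto simp: B.le_def)
  define m where "m x = (THE y. mv_link A B X x y)" for x
  have m_eq: "m x = y" if "mv_link A B X x y" for x y
    unfolding m_def using that unique by blast
  have m: "mv_link A B X x (m x)" if "x \<in> carrier A" for x
    using total[OF that] m_eq by blast
  have "mv_morphism A B m"
    unfolding mv_morphism_def using m closed
    by (auto intro!: m_eq mv_link.zero mv_link.neg mv_link.plus)
  moreover have "m x = y" if "(x, y) \<in> X" for x y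
    using that by (intro m_eq mv_link.base)
  ultimately show ?thesis using that by blast
qed

lemma mv_morphism_into_subuniverse:
  "mv_morphism A B f \<Longrightarrow> f ` carrier A \<subseteq> S \<Longrightarrow> mv_morphism A (B\<lparr>carrier := S\<rparr>) f"
  by (auto simp: mv_morphism_def)

text \<open>A subuniverse of the generated subalgebra is also one of \<open>A\<close>, so generating
  inside the smaller algebra gives nothing smaller.\<close>

lemma mv_generated_generated:
  assumes "is_mv_algebra A" "X \<subseteq> carrier A"
  shows "mv_generated (A\<lparr>carrier := mv_generated A X\<rparr>) X = mv_generated A X"
    (is "mv_generated ?G X = _")
proof
  have sub: "mv_subuniverse A (mv_generated A X)"
    by (rule mv_subuniverse_generated) fact+
  note mv = is_mv_algebra_subuniverse[OF assms(1) sub]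
  show "mv_generated ?G X \<subseteq> mv_generated A X"
    using mv_generated_least[OF mv_subuniverse_carrier[OF mv]] mv_generated_superset[of X A] by simp
  have "mv_subuniverse ?G (mv_generated ?G X)"
    using mv_generated_superset[of X A] by (intro mv_subuniverse_generated mv) simp
  then have "mv_subuniverse A (mv_generated ?G X)"
    using mv_subuniverseD(1)[OF sub] by (auto simp: mv_subuniverse_def)
  then show "mv_generated A X \<subseteq> mv_generated ?G X"
    by (intro mv_generated_least mv_generated_superset)
qed

text \<open>The coproduct is the subalgebra generated by the evaluations in a power of one chain,
  indexed by all families of homomorphisms from the \<open>X i\<close> to this chain. Local
  finiteness replaces a target by the finite subalgebra that the images generate, whose points are
  separated by homomorphisms to the unit interval.\<close>

lemma finite_coproduct_model:
  fixes X :: "'i \<Rightarrow> 'a mv_algebra"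
  assumes "finite I" and X: "\<And>i. i \<in> I \<Longrightarrow> is_mv_algebra (X i)" "\<And>i. i \<in> I \<Longrightarrow> finite (carrier (X i))"
  obtains P :: "(('i \<Rightarrow> 'a \<Rightarrow> real) \<Rightarrow> real) mv_algebra" and \<iota> where
    "is_mv_algebra P" "finite (carrier P)" "\<And>i. i \<in> I \<Longrightarrow> mv_morphism (X i) P (\<iota> i)"
    "mv_generated P (\<Union>i\<in>I. \<iota> i ` carrier (X i)) = carrier P"
    "\<And>(Z :: 'a mv_algebra) k. \<lbrakk>is_mv_algebra Z; locally_finite_mv Z;
         \<And>i. i \<in> I \<Longrightarrow> mv_morphism (X i) Z (k i)\<rbrakk>
       \<Longrightarrow> \<exists>m. mv_morphism P Z m \<and> (\<forall>i \<in> I. \<forall>x \<in> carrier (X i). m (\<iota> i x) = k i x)"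
proof -
  obtain M where M: "\<And>i. i \<in> I \<Longrightarrow> card (carrier (X i)) \<le> M"
    using finite_imageI[OF \<open>finite I\<close>, of "\<lambda>i. card (carrier (X i))"]
    by (metis finite_nat_set_iff_bounded_le imageI)
  \<comment> \<open>This chain contains the image of every homomorphism from an \<open>X i\<close>
    to the unit interval, since all denominators divide \<open>fact M\<close>.\<close>
  define L where "L = real_mv (rational_chain (fact M))"
  define T where "T = (\<Pi>\<^sub>E i\<in>I. {h \<in> carrier (X i) \<rightarrow>\<^sub>E rational_chain (fact M).
    mv_morphism (X i) unit_mv h})"
  define \<iota> where "\<iota> i x = (\<lambda>\<tau>\<in>T. \<tau> i x)" for i x
  define B where "B = mv_power L T"
  define W where "W = (\<Union>i\<in>I. \<iota> i ` carrier (X i))"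
  define P where "P = B\<lparr>carrier := mv_generated B W\<rparr>"
  have "is_mv_algebra L"
    unfolding L_def by (intro is_mv_algebra_real_mv mv_subuniverse_rational_chain) simp
  then have B: "is_mv_algebra B"
    unfolding B_def by (rule is_mv_algebra_power)
  have "finite (carrier (X i) \<rightarrow>\<^sub>E rational_chain (fact M))" if "i \<in> I" for i
    using X(2)[OF that] by (intro finite_PiE) auto
  then have "finite T"
    unfolding T_def using \<open>finite I\<close> by (intro finite_PiE) auto
  then have "finite (carrier B)"
    by (auto simp: B_def mv_power_def L_def intro!: finite_PiE)
  have \<iota>B: "mv_morphism (X i) B (\<iota> i)" if "i \<in> I" for i
    unfolding B_def \<iota>_def using X(1)[OF that]
  proof (rule mv_morphism_power_tuple)
    fix \<tau> assume "\<tau> \<in> T"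
    then have "mv_morphism (X i) unit_mv (\<tau> i)" "\<tau> i \<in> carrier (X i) \<rightarrow> rational_chain (fact M)"
      using that by (auto simp: T_def PiE_iff)
    then show "mv_morphism (X i) L (\<tau> i)"
      by (auto simp: mv_morphism_def L_def)
  qed
  have W: "W \<subseteq> carrier B"
    unfolding W_def using mv_morphismD(1)[OF \<iota>B] by blast
  have sub: "mv_subuniverse B (mv_generated B W)"
    by (rule mv_subuniverse_generated) fact+
  have P: "is_mv_algebra P"
    unfolding P_def by (rule is_mv_algebra_subuniverse) fact+
  have carrier_P: "carrier P = mv_generated B W"
    by (simp add: P_def)
  have "finite (carrier P)"
    using mv_subuniverseD(1)[OF sub] \<open>finite (carrier B)\<close> carrier_P finite_subset by metis
  moreover have \<iota>: "mv_morphism (X i) P (\<iota> i)" if "i \<in> I" for i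
    unfolding P_def using that mv_generated_superset[of W B]
    by (intro mv_morphism_into_subuniverse \<iota>B) (auto simp: W_def)
  moreover have gen: "mv_generated P W = carrier P"
    unfolding carrier_P by (simp add: P_def mv_generated_generated B W)
  moreover have "\<exists>m. mv_morphism P Z m \<and> (\<forall>i \<in> I. \<forall>x \<in> carrier (X i). m (\<iota> i x) = k i x)"
    if Z: "is_mv_algebra Z" "locally_finite_mv Z" and k: "\<And>i. i \<in> I \<Longrightarrow> mv_morphism (X i) Z (k i)"
    for Z :: "'a mv_algebra" and k
  proof -
    define Y where "Y = (\<Union>i\<in>I. (\<lambda>x. (\<iota> i x, k i x)) ` carrier (X i))"
    define V where "V = (\<Union>i\<in>I. k i ` carrier (X i))"
    define S where "S = mv_generated Z V"
    have "V \<subseteq> carrier Z"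
      unfolding V_def using mv_morphismD(1)[OF k] by blast
    have "finite V"
      unfolding V_def using \<open>finite I\<close> X(2) by auto
    then have "finite S"
      unfolding S_def using Z(2) \<open>V \<subseteq> carrier Z\<close> by (simp add: locally_finite_mv_def)
    have S: "mv_subuniverse Z S"
      unfolding S_def by (rule mv_subuniverse_generated) fact+
    have "V \<subseteq> S" unfolding S_def by (rule mv_generated_superset)
    have fstY: "fst ` Y = W"
      unfolding Y_def W_def by force
    have "Y \<subseteq> carrier P \<times> S"
      using \<open>V \<subseteq> S\<close> mv_generated_superset[of W P] unfolding gen by (auto simp: Y_def V_def W_def)
    \<comment> \<open>A nonzero \<open>z\<close> linked to zero would be separated from zero by some
      \<open>\<phi>\<close>. The composites of \<open>\<phi>\<close> with the \<open>k i\<close>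
      form a coordinate \<open>\<tau>\<close> in \<open>T\<close>, and reading off this coordinate
      contradicts \<open>\<phi> z \<noteq> 0\<close>.\<close>
    have "z = \<zero>\<^bsub>Z\<^esub>" if z: "mv_link P Z Y \<zero>\<^bsub>P\<^esub> z" for z
    proof (rule ccontr)
      assume "z \<noteq> \<zero>\<^bsub>Z\<^esub>"
      have "z \<in> S"
        using mv_link_closed[OF z mv_subuniverse_carrier[OF P] S \<open>Y \<subseteq> carrier P \<times> S\<close>] by blast
      define Z' where "Z' = Z\<lparr>carrier := S\<rparr>"
      have Z': "is_mv_algebra Z'"
        unfolding Z'_def by (rule is_mv_algebra_subuniverse) fact+
      obtain \<phi> where \<phi>: "mv_morphism Z' unit_mv \<phi>" "\<phi> z \<noteq> 0"
        using finite_mv_algebra_separating[OF Z', of z] \<open>finite S\<close> \<open>z \<in> S\<close> \<open>z \<noteq> \<zero>\<^bsub>Z\<^esub>\<close>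
        by (auto simp: Z'_def)
      define \<tau> where "\<tau> = (\<lambda>i\<in>I. \<lambda>x\<in>carrier (X i). \<phi> (k i x))"
      have \<tau>_apply: "\<tau> i x = \<phi> (k i x)" if "i \<in> I" "x \<in> carrier (X i)" for i x
        using that by (simp add: \<tau>_def)
      have \<phi>k: "mv_morphism (X i) unit_mv (\<lambda>x. \<phi> (k i x))" if "i \<in> I" for i
      proof -
        have "mv_morphism (X i) Z' (k i)"
          unfolding Z'_def using that \<open>V \<subseteq> S\<close>
          by (intro mv_morphism_into_subuniverse k) (auto simp: V_def)
        then show ?thesis using \<phi>(1) by (rule mv_morphism_comp)
      qed
      have "\<tau> \<in> T"
        unfolding T_def
      proof (rule PiE_I)
        fix i assume i: "i \<in> I"
        obtain d where d: "0 < d" "d < M" "(\<lambda>x. \<phi> (k i x)) ` carrier (X i) \<subseteq> rational_chain d"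
          using mv_morphism_into_rational_chain[OF X(1)[OF i] X(2)[OF i] M[OF i] \<phi>k[OF i]] by blast
        moreover have "rational_chain d \<subseteq> rational_chain (fact M)"
          using d by (intro rational_chain_mono dvd_fact) auto
        moreover have "mv_morphism (X i) unit_mv (\<tau> i)"
          using i X(1) \<phi>k[OF i] by (intro mv_morphism_cong[OF _ \<phi>k[OF i]]) (auto simp: \<tau>_def)
        ultimately
        show "\<tau> i \<in> {h \<in> carrier (X i) \<rightarrow>\<^sub>E rational_chain (fact M).
            mv_morphism (X i) unit_mv h}"
          using i by (auto simp: \<tau>_def)
      qed (simp add: \<tau>_def)
      have P_ops: "\<zero>\<^bsub>P\<^esub> \<tau> = 0" "(\<sim>\<^bsub>P\<^esub> p) \<tau> = 1 - p \<tau>" "(p \<oplus>\<^bsub>P\<^esub> p') \<tau> = min 1 (p \<tau> + p' \<tau>)" for p p'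
        using \<open>\<tau> \<in> T\<close> by (simp_all add: P_def B_def mv_power_def L_def)
      have \<phi>_ops: "\<phi> \<zero>\<^bsub>Z\<^esub> = 0" "y \<in> S \<Longrightarrow> \<phi> (\<sim>\<^bsub>Z\<^esub> y) = 1 - \<phi> y"
        "\<lbrakk>y \<in> S; y' \<in> S\<rbrakk> \<Longrightarrow> \<phi> (y \<oplus>\<^bsub>Z\<^esub> y') = min 1 (\<phi> y + \<phi> y')" for y y'
        using mv_morphismD(2-)[OF \<phi>(1)] by (simp_all add: Z'_def)
      note in_S = mv_link_closed[OF _ mv_subuniverse_carrier[OF P] S \<open>Y \<subseteq> carrier P \<times> S\<close>,
        THEN conjunct2]
      \<comment> \<open>Along the link relation the coordinate \<open>\<tau>\<close> computes
        \<open>\<phi>\<close>; on generators it does so by the choice of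
        \<open>\<tau>\<close>.\<close>
      have "p \<tau> = \<phi> y" if "mv_link P Z Y p y" for p y
        using that
      proof induction
        case (base p y)
        then show ?case using \<open>\<tau> \<in> T\<close> \<tau>_apply by (auto simp: Y_def \<iota>_def)
      qed (simp_all add: P_ops \<phi>_ops in_S)
      from this[OF z] \<phi>(2) show False by (simp add: P_ops)
    qed
    then obtain m where m: "mv_morphism P Z m" "\<And>x y. (x, y) \<in> Y \<Longrightarrow> m x = y"
      using mv_link_extension[OF P Z(1), of Y] \<open>Y \<subseteq> carrier P \<times> S\<close> mv_subuniverseD(1)[OF S] gen fstY
      by blast
    have "m (\<iota> i x) = k i x" if "i \<in> I" "x \<in> carrier (X i)" for i x
      using that by (intro m(2)) (auto simp: Y_def)
    with m(1) show ?thesis by blast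
  qed
  ultimately show ?thesis
    using that[of P \<iota>] P unfolding W_def by blast
qed

text \<open>Serves to bring algebras built over other types into the type \<open>'u\<close> over
  which the objects of \<open>MV_lf\<close> live.\<close>

lemma mv_transport:
  assumes P: "is_mv_algebra P" and b: "inj_on b (carrier P)"
  obtains Q where "is_mv_algebra Q" "carrier Q = b ` carrier P"
    "mv_morphism P Q b" "mv_morphism Q P (inv_into (carrier P) b)"
proof -
  interpret mv_alg P by unfold_locales fact
  define c where "c = inv_into (carrier P) b"
  have c [simp]: "c (b x) = x" if "x \<in> carrier P" for x
    using b that by (simp add: c_def)
  define Q where "Q = \<lparr>carrier = b ` carrier P, mv_plus = (\<lambda>x y. b (mv_plus P (c x) (c y))),
    mv_neg = (\<lambda>x. b (mv_neg P (c x))), mv_zero = b (mv_zero P)\<rparr>"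
  have "comm_monoid \<lparr>carrier = carrier Q, mult = mv_plus Q, one = mv_zero Q\<rparr>"
    by unfold_locales (auto simp: Q_def plus_ac)
  then have "is_mv_algebra Q"
    using sup_comm by (auto simp: is_mv_algebra_def Q_def minus_def)
  moreover have "mv_morphism P Q b" "mv_morphism Q P c"
    by (auto simp: mv_morphism_def Q_def)
  ultimately show ?thesis
    using that by (auto simp: Q_def c_def)
qed

lemma mv_generated_finite:
  assumes "is_mv_algebra A" "finite (carrier A)" "X \<subseteq> carrier A"
  shows "finite (mv_generated A X)"
  using assms by (meson finite_subset mv_generated_least mv_subuniverse_carrier)

section \<open>Objects, arrows and finite coproducts of \<open>MV_lf\<close>\<close>

lemma Obj_MV_lf:
  "A \<in> Obj (MV_lf TYPE('u)) \<longleftrightarrow>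
    is_mv_algebra A \<and> locally_finite_mv A \<and> small TYPE('u) (carrier (A :: 'u mv_algebra))"
  by (simp add: MV_lf_def)

lemma Obj_MV_lfD:
  assumes "A \<in> Obj (MV_lf TYPE('u))"
  shows "is_mv_algebra A" and "locally_finite_mv A" and "small TYPE('u) (carrier (A :: 'u mv_algebra))"
  using assms by (simp_all add: Obj_MV_lf)

lemma finite_Obj_MV_lf:
  assumes "infinite (UNIV :: 'u set)" "is_mv_algebra A" "finite (carrier (A :: 'u mv_algebra))"
  shows "A \<in> Obj (MV_lf TYPE('u))"
  using assms mv_generated_finite
  by (auto simp: Obj_MV_lf locally_finite_mv_def small_def intro: finite_lesspoll_infinite)

lemma Hom_MV_lf:
  "a \<in> Hom (MV_lf TYPE('u)) A B \<longleftrightarrow>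
    (\<exists>f. a = (A, f, B) \<and> A \<in> Obj (MV_lf TYPE('u)) \<and> B \<in> Obj (MV_lf TYPE('u)) \<and>
      mv_morphism A B f \<and> f \<in> extensional (carrier A))"
  by (auto simp: MV_lf_def Hom_def mv_hom_iff)

lemma Comp_MV_lf [simp]: "Comp (MV_lf U) (B, g, C) (A, f, B') = (A, compose (carrier A) g f, C)"
  by (simp add: MV_lf_def)

lemma Dom_Cod_MV_lf [simp]: "Dom (MV_lf U) (A, f, B) = A" "Cod (MV_lf U) (A, f, B) = B"
  by (simp_all add: MV_lf_def)

lemma restrict_in_Hom_MV_lf:
  assumes "A \<in> Obj (MV_lf TYPE('u))" "B \<in> Obj (MV_lf TYPE('u))" "mv_morphism A B f"
  shows "(A, restrict f (carrier A), B) \<in> Hom (MV_lf TYPE('u)) A B"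
  using assms mv_morphism_cong[OF Obj_MV_lfD(1)[OF assms(1)] assms(3), of "restrict f (carrier A)"]
  by (auto simp: Hom_MV_lf)

text \<open>The finite model embeds into the infinite type \<open>'u\<close>, so it has a copy among
  the objects. Mediating arrows are unique because the images of the summands generate
  \<open>P\<close>.\<close>

lemma MV_lf_finite_coproduct_exists:
  fixes X :: "'i \<Rightarrow> 'u mv_algebra"
  assumes inf: "infinite (UNIV :: 'u set)" and "finite I"
    and X: "\<And>i. i \<in> I \<Longrightarrow> X i \<in> Obj (MV_lf TYPE('u))" "\<And>i. i \<in> I \<Longrightarrow> finite (carrier (X i))"
  obtains Q \<kappa> where "is_coproduct (MV_lf TYPE('u)) I X Q \<kappa>"
proof -
  note mvX = Obj_MV_lfD(1)[OF X(1)]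
  obtain P :: "(('i \<Rightarrow> 'u \<Rightarrow> real) \<Rightarrow> real) mv_algebra" and \<iota> where
    P: "is_mv_algebra P" "finite (carrier P)" and \<iota>: "\<And>i. i \<in> I \<Longrightarrow> mv_morphism (X i) P (\<iota> i)"
    and gen: "mv_generated P (\<Union>i\<in>I. \<iota> i ` carrier (X i)) = carrier P"
    and extend: "\<And>(Z :: 'u mv_algebra) k. \<lbrakk>is_mv_algebra Z; locally_finite_mv Z;
         \<And>i. i \<in> I \<Longrightarrow> mv_morphism (X i) Z (k i)\<rbrakk>
       \<Longrightarrow> \<exists>m. mv_morphism P Z m \<and> (\<forall>i \<in> I. \<forall>x \<in> carrier (X i). m (\<iota> i x) = k i x)"
    using finite_coproduct_model[of I X, OF \<open>finite I\<close> mvX X(2)] by blast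
  obtain b :: "(('i \<Rightarrow> 'u \<Rightarrow> real) \<Rightarrow> real) \<Rightarrow> 'u" where b: "inj_on b (carrier P)"
    using finite_lepoll_infinite[OF inf P(2)] by (auto simp: lepoll_def)
  define c where "c = inv_into (carrier P) b"
  obtain Q where Q: "is_mv_algebra Q" "carrier Q = b ` carrier P" "mv_morphism P Q b" "mv_morphism Q P c"
    unfolding c_def using mv_transport[OF P(1) b] by blast
  have cb: "c (b x) = x" if "x \<in> carrier P" for x
    using b that by (simp add: c_def)
  have QO: "Q \<in> Obj (MV_lf TYPE('u))"
    using inf Q(1,2) P(2) by (intro finite_Obj_MV_lf) auto
  define \<kappa> where "\<kappa> i = (X i, restrict (\<lambda>x. b (\<iota> i x)) (carrier (X i)), Q)" for i
  note \<iota>_in = mv_morphismD(1)[OF \<iota>]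
  define W where "W = (\<Union>i\<in>I. \<iota> i ` carrier (X i))"
  have W_sub: "W \<subseteq> carrier P"
    using \<iota>_in by (auto simp: W_def)
  have "is_coproduct (MV_lf TYPE('u)) I X Q \<kappa>"
    unfolding is_coproduct_def
  proof (intro conjI ballI allI impI QO)
    show "\<kappa> i \<in> Hom (MV_lf TYPE('u)) (X i) Q" if "i \<in> I" for i
      unfolding \<kappa>_def
      by (rule restrict_in_Hom_MV_lf[OF X(1)[OF that] QO mv_morphism_comp[OF \<iota>[OF that] Q(3)]])
    fix Z k assume Z: "Z \<in> Obj (MV_lf TYPE('u))" and k: "\<forall>i\<in>I. k i \<in> Hom (MV_lf TYPE('u)) (X i) Z"
    define g where "g i = fst (snd (k i))" for i
    have g: "k i = (X i, g i, Z)" "mv_morphism (X i) Z (g i)" "g i \<in> extensional (carrier (X i))"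
      if "i \<in> I" for i
      using k that by (auto simp: g_def Hom_MV_lf)
    obtain m where m: "mv_morphism P Z m" "\<And>i x. i \<in> I \<Longrightarrow> x \<in> carrier (X i) \<Longrightarrow> m (\<iota> i x) = g i x"
      using extend[OF Obj_MV_lfD(1,2)[OF Z] g(2)] by blast
    define m' where "m' = (Q, restrict (\<lambda>x. m (c x)) (carrier Q), Z)"
    show "\<exists>!m. m \<in> Hom (MV_lf TYPE('u)) Q Z \<and> (\<forall>i\<in>I. Comp (MV_lf TYPE('u)) m (\<kappa> i) = k i)"
    proof (rule ex1I[of _ m'])
      have "compose (carrier (X i)) (restrict (\<lambda>x. m (c x)) (carrier Q))
          (restrict (\<lambda>x. b (\<iota> i x)) (carrier (X i))) = g i"
        if "i \<in> I" for i
        using that g(3)[OF that] \<iota>_in[OF that] m(2) cb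
        by (intro ext) (simp add: compose_def extensional_def Q(2))
      moreover have "m' \<in> Hom (MV_lf TYPE('u)) Q Z"
        using restrict_in_Hom_MV_lf[OF QO Z mv_morphism_comp[OF Q(4) m(1)]] by (simp add: m'_def)
      ultimately show "m' \<in> Hom (MV_lf TYPE('u)) Q Z \<and> (\<forall>i\<in>I. Comp (MV_lf TYPE('u)) m' (\<kappa> i) = k i)"
        by (simp add: m'_def \<kappa>_def g(1))
      fix n assume n: "n \<in> Hom (MV_lf TYPE('u)) Q Z \<and> (\<forall>i\<in>I. Comp (MV_lf TYPE('u)) n (\<kappa> i) = k i)"
      then obtain h where h: "n = (Q, h, Z)" "mv_morphism Q Z h" "h \<in> extensional (carrier Q)"
        by (auto simp: Hom_MV_lf)
      have "h (b (\<iota> i x)) = m (\<iota> i x)" if "i \<in> I" "x \<in> carrier (X i)" for i x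
      proof -
        have "compose (carrier (X i)) h (restrict (\<lambda>x. b (\<iota> i x)) (carrier (X i))) = g i"
          using n[THEN conjunct2, rule_format, OF that(1)] g(1)[OF that(1)] by (simp add: h(1) \<kappa>_def)
        from fun_cong[OF this, of x] show ?thesis
          using that m(2) by (simp add: compose_def)
      qed
      then have "h (b p) = m p" if "p \<in> mv_generated P W" for p
        using mv_morphism_eq_on_generated[OF P(1) W_sub mv_morphism_comp[OF Q(3) h(2)] m(1) _ that]
        by (auto simp: W_def)
      then have "h = restrict (\<lambda>x. m (c x)) (carrier Q)"
        using h(3) cb gen by (intro ext) (auto simp: extensional_def Q(2) W_def)
      then show "n = m'" by (simp add: h(1) m'_def)
    qed
  qed
  then show ?thesis by (rule that)
qed

section \<open>Finitely generated objects are finite\<close>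

lemma infinite_times_self_lepoll: "infinite A \<Longrightarrow> A \<times> A \<lesssim> A"
  using card_of_Times_same_infinite[of A] by (simp add: eqpoll_imp_lepoll eqpoll_iff_card_of_ordIso)

text \<open>Finite sets are coded by lists, and lists by their length and an iterated pairing.\<close>

lemma Fpow_lepoll:
  assumes "infinite A"
  shows "Fpow A \<lesssim> A"
proof -
  have sq: "A \<times> A \<lesssim> A"
    using assms by (rule infinite_times_self_lepoll)
  then obtain p where p: "inj_on p (A \<times> A)" "p ` (A \<times> A) \<subseteq> A"
    by (auto simp: lepoll_def)
  obtain a where "a \<in> A" using assms by fastforce
  \<comment> \<open>\<open>a\<close> is an arbitrary code for the empty list. It may also be the
    code of a pair, so \<open>enc\<close> is only shown injective on lists of equal length, and the
    length is kept alongside.\<close>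
  define enc where "enc xs = foldr (\<lambda>x r. p (x, r)) xs a" for xs
  have enc_in: "enc xs \<in> A" if "xs \<in> lists A" for xs
    using that by induction (use p(2) \<open>a \<in> A\<close> in \<open>auto simp: enc_def\<close>)
  have "xs = ys" if "length xs = length ys" "xs \<in> lists A" "ys \<in> lists A" "enc xs = enc ys" for xs ys
    using that
  proof (induction rule: list_induct2)
    case (Cons x xs y ys)
    then have "p (x, enc xs) = p (y, enc ys)" by (simp add: enc_def)
    moreover have "(x, enc xs) \<in> A \<times> A" "(y, enc ys) \<in> A \<times> A"
      using Cons.prems enc_in by auto
    ultimately have "(x, enc xs) = (y, enc ys)" by (rule inj_onD[OF p(1)])
    then show ?case using Cons by simp
  qed simp
  then have "inj_on (\<lambda>xs. (length xs, enc xs)) (lists A)"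
    by (auto simp: inj_on_def)
  then have "lists A \<lesssim> (UNIV :: nat set) \<times> A"
    using enc_in unfolding lepoll_def by (intro exI[of _ "\<lambda>xs. (length xs, enc xs)"]) auto
  also have "\<dots> \<lesssim> A \<times> A"
    using assms by (intro times_lepoll_mono) (auto simp: infinite_le_lepoll)
  also note sq
  finally have "lists A \<lesssim> A" .
  moreover have "Fpow A \<subseteq> set ` lists A"
    unfolding Fpow_def using finite_list by (fastforce simp: image_iff)
  ultimately show ?thesis
    using subset_image_lepoll[of "Fpow A" set "lists A"] lepoll_trans[of "Fpow A" "lists A" A] by simp
qed

section \<open>Colimits in the category of sets\<close>

lemma set_category_cocone_component:
  assumes "is_cocone set_category J Fo Fa L c" "i \<in> Obj J"
  shows "c i = (Fo i, fst (snd (c i)), L)" and "fst (snd (c i)) \<in> Fo i \<rightarrow>\<^sub>E L"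
proof -
  have "c i \<in> Hom set_category (Fo i) L"
    using assms by (simp add: is_cocone_def)
  then show "c i = (Fo i, fst (snd (c i)), L)" "fst (snd (c i)) \<in> Fo i \<rightarrow>\<^sub>E L"
    by (cases "c i"; simp add: Hom_def set_category_def)+
qed

lemma Comp_set_category [simp]: "Comp set_category (Y, g, Z) (X, f, Y') = (X, compose X g f, Z)"
  by (simp add: set_category_def)

text \<open>If the cocone missed \<open>x\<close>, two maps to a two-element set that differ only at
  \<open>x\<close> would mediate the same cocone. The elements \<open>a\<close> and \<open>b\<close>
  supply this set inside the type.\<close>

lemma set_category_colimit_jointly_surjective:
  fixes a b :: 'x and L :: "'x set"
  assumes colim: "is_colimit set_category J Fo Fa L c" and J: "is_category J"
    and Fa: "\<And>i j u. u \<in> Hom J i j \<Longrightarrow> Fa u \<in> Hom set_category (Fo i) (Fo j)"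
    and "x \<in> L" and "a \<noteq> b"
  shows "\<exists>i\<in>Obj J. \<exists>y\<in>Fo i. fst (snd (c i)) y = x"
proof (rule ccontr)
  assume "\<not> ?thesis"
  then have no: "fst (snd (c i)) y \<noteq> x" if "i \<in> Obj J" "y \<in> Fo i" for i y
    using that by blast
  have cocone: "is_cocone set_category J Fo Fa L c"
    using colim by (simp add: is_colimit_def)
  note c = set_category_cocone_component[OF cocone]
  define m1 where "m1 = (L, (\<lambda>z\<in>L. a), {a, b})"
  define m2 where "m2 = (L, (\<lambda>z\<in>L. if z = x then b else a), {a, b})"
  define d where "d i = Comp set_category m1 (c i)" for i
  have m: "m1 \<in> Hom set_category L {a, b}" "m2 \<in> Hom set_category L {a, b}"
    by (auto simp: m1_def m2_def Hom_def set_category_def)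
  have "is_cocone set_category J Fo Fa {a, b} d"
    unfolding is_cocone_def
  proof (intro conjI ballI allI)
    show "{a, b} \<in> Obj set_category" by (simp add: set_category_def)
    show "d i \<in> Hom set_category (Fo i) {a, b}" if "i \<in> Obj J" for i
      using cocone m(1) that is_category_set_category
      unfolding d_def is_cocone_def is_category_def by blast
    show "Comp set_category (d j) (Fa u) = d i" if u: "u \<in> Hom J i j" for i j u
    proof -
      have "j \<in> Obj J" using u J by (auto simp: is_category_def Hom_def)
      then have "c j \<in> Hom set_category (Fo j) L" "Comp set_category (c j) (Fa u) = c i"
        using cocone u by (auto simp: is_cocone_def)
      with Fa[OF u] m(1) is_category_set_category show ?thesis
        unfolding d_def is_category_def by metis
    qed
  qed
  then have "\<exists>!m. m \<in> Hom set_category L {a, b} \<and> (\<forall>i\<in>Obj J. Comp set_category m (c i) = d i)"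
    using colim by (simp add: is_colimit_def)
  moreover have "Comp set_category m2 (c i) = d i" if "i \<in> Obj J" for i
  proof -
    have "compose (Fo i) (\<lambda>z\<in>L. if z = x then b else a) (fst (snd (c i))) =
        compose (Fo i) (\<lambda>z\<in>L. a) (fst (snd (c i)))"
      using no[OF that] by (auto simp: compose_def)
    then show ?thesis
      unfolding d_def m1_def m2_def by (subst (1 2) c(1)[OF that]) simp
  qed
  moreover have "Comp set_category m1 (c i) = d i" for i
    by (simp add: d_def)
  ultimately have "m1 = m2"
    using m by blast
  then have "(\<lambda>z\<in>L. a) x = (\<lambda>z\<in>L. if z = x then b else a) x"
    by (simp add: m1_def m2_def)
  with \<open>x \<in> L\<close> \<open>a \<noteq> b\<close> show False by simp
qed

text \<open>
  The directed poset \<open>F\<close> as a category: \<open>e\<close> encodes the inclusion of \<open>S\<close> in \<open>T\<close> as \<open>e (S, T)\<close>,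
  and the object \<open>S\<close> by its identity \<open>e (S, S)\<close>.
\<close>

locale inclusion_index =
  fixes e :: "'s set \<times> 's set \<Rightarrow> 'u" and F :: "'s set set"
  assumes inj: "inj_on e (F \<times> F)"
    and nonempty: "F \<noteq> {}"
    and directed: "\<lbrakk>S \<in> F; T \<in> F\<rbrakk> \<Longrightarrow> \<exists>U\<in>F. S \<subseteq> U \<and> T \<subseteq> U"
begin

definition src :: "'u \<Rightarrow> 's set" where "src u = fst (inv_into (F \<times> F) e u)"
definition tgt :: "'u \<Rightarrow> 's set" where "tgt u = snd (inv_into (F \<times> F) e u)"

lemma src_e [simp]: "\<lbrakk>S \<in> F; T \<in> F\<rbrakk> \<Longrightarrow> src (e (S, T)) = S"
  and tgt_e [simp]: "\<lbrakk>S \<in> F; T \<in> F\<rbrakk> \<Longrightarrow> tgt (e (S, T)) = T"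
  using inj by (simp_all add: src_def tgt_def)

lemma e_eq_iff [simp]:
  "\<lbrakk>S \<in> F; T \<in> F; S' \<in> F; T' \<in> F\<rbrakk> \<Longrightarrow> e (S, T) = e (S', T') \<longleftrightarrow> S = S' \<and> T = T'"
  using inj by (auto dest: inj_onD)

definition incl_cat :: "('u, 'u) category" where
  "incl_cat = \<lparr>Obj = (\<lambda>S. e (S, S)) ` F, Arr = e ` {(S, T). S \<in> F \<and> T \<in> F \<and> S \<subseteq> T},
    Dom = (\<lambda>u. e (src u, src u)), Cod = (\<lambda>u. e (tgt u, tgt u)), Id = (\<lambda>i. i),
    Comp = (\<lambda>v u. e (src u, tgt v))\<rparr>"

lemma Obj_incl_cat: "i \<in> Obj incl_cat \<longleftrightarrow> (\<exists>S\<in>F. i = e (S, S))"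
  by (auto simp: incl_cat_def)

lemma Hom_incl_cat: "u \<in> Hom incl_cat i j \<longleftrightarrow>
    (\<exists>S\<in>F. \<exists>T\<in>F. S \<subseteq> T \<and> u = e (S, T) \<and> i = e (S, S) \<and> j = e (T, T))"
  by (auto simp: incl_cat_def Hom_def)

lemma e_in_Obj: "S \<in> F \<Longrightarrow> e (S, S) \<in> Obj incl_cat"
  by (auto simp: Obj_incl_cat)

lemma e_in_Hom: "\<lbrakk>S \<in> F; T \<in> F; S \<subseteq> T\<rbrakk> \<Longrightarrow> e (S, T) \<in> Hom incl_cat (e (S, S)) (e (T, T))"
  by (auto simp: Hom_incl_cat)

lemma Comp_incl_cat [simp]:
  "\<lbrakk>S \<in> F; T \<in> F; T' \<in> F; U \<in> F\<rbrakk> \<Longrightarrow> Comp incl_cat (e (T', U)) (e (S, T)) = e (S, U)"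
  and Id_incl_cat [simp]: "Id incl_cat i = i"
  by (simp_all add: incl_cat_def)

lemma is_category_incl_cat: "is_category incl_cat"
proof -
  have "Dom incl_cat f \<in> Obj incl_cat \<and> Cod incl_cat f \<in> Obj incl_cat" if "f \<in> Arr incl_cat" for f
    using that by (auto simp: incl_cat_def)
  then show ?thesis
    unfolding is_category_def by (auto simp: Hom_incl_cat Obj_incl_cat)
qed

lemma filtered_incl_cat: "filtered incl_cat"
  unfolding filtered_def
proof (intro conjI ballI allI is_category_incl_cat)
  show "Obj incl_cat \<noteq> {}" using nonempty by (simp add: incl_cat_def)
next
  fix i j assume "i \<in> Obj incl_cat" "j \<in> Obj incl_cat"
  then obtain S T where S: "S \<in> F" "i = e (S, S)" and T: "T \<in> F" "j = e (T, T)"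
    by (auto simp: Obj_incl_cat)
  then obtain U where "U \<in> F" "S \<subseteq> U" "T \<subseteq> U"
    using directed by blast
  then have "e (S, U) \<in> Hom incl_cat i (e (U, U))" "e (T, U) \<in> Hom incl_cat j (e (U, U))"
    "e (U, U) \<in> Obj incl_cat"
    using S T by (auto simp: Hom_incl_cat Obj_incl_cat)
  then show "\<exists>k\<in>Obj incl_cat. Hom incl_cat i k \<noteq> {} \<and> Hom incl_cat j k \<noteq> {}" by blast
next
  fix i j u v assume "u \<in> Hom incl_cat i j" "v \<in> Hom incl_cat i j"
  then have "u = v" by (auto simp: Hom_incl_cat)
  \<comment> \<open>An object doubles as its own identity arrow, so \<open>j\<close> serves as the
    arrow merging a pair that already agrees.\<close>
  moreover have "j \<in> Hom incl_cat j j" using \<open>u \<in> Hom incl_cat i j\<close> by (auto simp: Hom_incl_cat)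
  ultimately show "\<exists>k. \<exists>w\<in>Hom incl_cat j k. Comp incl_cat w u = Comp incl_cat w v" by blast
qed

end

section \<open>Locally finite algebras as colimits of their finite subalgebras\<close>

lemma compose_restrict_id: "compose S f (\<lambda>x\<in>S. x) = restrict f S"
  by (auto simp: compose_def)

definition incl_arrow :: "'u mv_algebra \<Rightarrow> 'u set \<Rightarrow> 'u mv_algebra \<Rightarrow> 'u mv_arrow" where
  "incl_arrow G S B = (G\<lparr>carrier := S\<rparr>, \<lambda>x\<in>S. x, B)"

lemma incl_arrow_in_Hom:
  assumes "G\<lparr>carrier := S\<rparr> \<in> Obj (MV_lf TYPE('u))" "G\<lparr>carrier := T\<rparr> \<in> Obj (MV_lf TYPE('u))"
    and "S \<subseteq> (T :: 'u set)"
  shows "incl_arrow G S (G\<lparr>carrier := T\<rparr>) \<in>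
    Hom (MV_lf TYPE('u)) (G\<lparr>carrier := S\<rparr>) (G\<lparr>carrier := T\<rparr>)"
  using restrict_in_Hom_MV_lf[OF assms(1,2), of "\<lambda>x. x"] assms(3)
  by (auto simp: incl_arrow_def mv_morphism_def)

lemma monic_MV_lf:
  assumes m: "m \<in> Hom (MV_lf TYPE('u)) A B" and inj: "inj_on (fst (snd m)) (carrier A)"
  shows "monic (MV_lf TYPE('u)) m"
  unfolding monic_def
proof (intro conjI allI ballI impI)
  show "m \<in> Arr (MV_lf TYPE('u))" using m by (simp add: Hom_def)
  obtain h where h: "m = (A, h, B)" using m by (auto simp: Hom_MV_lf)
  fix X f g
  assume "f \<in> Hom (MV_lf TYPE('u)) X (Dom (MV_lf TYPE('u)) m)"
    and "g \<in> Hom (MV_lf TYPE('u)) X (Dom (MV_lf TYPE('u)) m)"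
  then obtain f' g' where f: "f = (X, f', A)" "mv_morphism X A f'" "f' \<in> extensional (carrier X)"
    and g: "g = (X, g', A)" "mv_morphism X A g'" "g' \<in> extensional (carrier X)"
    by (auto simp: Hom_MV_lf h)
  assume "Comp (MV_lf TYPE('u)) m f = Comp (MV_lf TYPE('u)) m g"
  then have eq: "compose (carrier X) h f' = compose (carrier X) h g'"
    by (simp add: h f(1) g(1))
  have "f' x = g' x" if "x \<in> carrier X" for x
    using fun_cong[OF eq, of x] that inj mv_morphismD(1)[OF f(2) that] mv_morphismD(1)[OF g(2) that]
    by (auto simp: h compose_def dest: inj_onD)
  then have "f' = g'"
    by (intro extensionalityI[OF f(3) g(3)])
  then show "f = g" by (simp add: f(1) g(1))
qed

text \<open>An infinite carrier has at most as many finite subalgebras as elements, so the diagram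
  of finite subalgebras is small and the definition applies to it. Factoring the identity through
  one of them then bounds the carrier.\<close>

lemma finitely_generated_object_imp_finite:
  assumes inf: "infinite (UNIV :: 'u set)"
    and fg: "finitely_generated_object TYPE('u) (MV_lf TYPE('u)) (G :: 'u mv_algebra)"
  shows "finite (carrier G)"
proof (rule ccontr)
  assume infG: "infinite (carrier G)"
  let ?C = "MV_lf TYPE('u)"
  have G: "G \<in> Obj ?C"
    using fg by (simp add: finitely_generated_object_def)
  note mvG = Obj_MV_lfD(1)[OF G]
  define F where "F = {S. finite S \<and> mv_subuniverse G S}"
  \<comment> \<open>Local finiteness enters here: every finite set of elements lies in a member of
    \<open>F\<close>, which makes \<open>F\<close> directed.\<close>
  have gen_F: "mv_generated G X \<in> F" if "X \<subseteq> carrier G" "finite X" for X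
    using that Obj_MV_lfD(2)[OF G] mv_subuniverse_generated[OF mvG that(1)]
    by (auto simp: F_def locally_finite_mv_def)
  have F_sub: "S \<subseteq> carrier G" if "S \<in> F" for S
    using that mv_subuniverseD(1) by (auto simp: F_def)
  have "F \<lesssim> Fpow (carrier G)"
    using F_sub by (intro subset_imp_lepoll) (auto simp: F_def Fpow_def)
  then have FG: "F \<lesssim> carrier G"
    using Fpow_lepoll[OF infG] lepoll_trans by blast
  have "carrier G \<times> carrier G \<lesssim> carrier G"
    using infG by (rule infinite_times_self_lepoll)
  then have FFG: "F \<times> F \<lesssim> carrier G"
    using times_lepoll_mono[OF FG FG] lepoll_trans by blast
  have smallG: "carrier G \<prec> (UNIV :: 'u set)"
    using Obj_MV_lfD(3)[OF G] by (simp add: small_def)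
  \<comment> \<open>Index categories have to live over \<open>'u\<close>, so pairs of finite
    subalgebras are coded by elements.\<close>
  obtain e :: "'u set \<times> 'u set \<Rightarrow> 'u" where e: "inj_on e (F \<times> F)"
    using FFG by (auto simp: lepoll_def)
  interpret inclusion_index e F
  proof
    show "inj_on e (F \<times> F)" by fact
    show "F \<noteq> {}" using gen_F[of "{}"] by auto
    fix S T assume "S \<in> F" "T \<in> F"
    then have "mv_generated G (S \<union> T) \<in> F"
      using F_sub by (intro gen_F) (auto simp: F_def)
    then show "\<exists>U\<in>F. S \<subseteq> U \<and> T \<subseteq> U"
      using mv_generated_superset[of "S \<union> T" G] by blast
  qed
  have "Obj incl_cat \<lesssim> F"
    by (simp add: incl_cat_def image_lepoll)
  then have smallO: "small TYPE('u) (Obj incl_cat)"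
    unfolding small_def using FG smallG lepoll_trans lesspoll_trans1 by blast
  have "Arr incl_cat \<lesssim> F \<times> F"
    by (rule subset_image_lepoll[of _ e]) (auto simp: incl_cat_def)
  then have smallA: "small TYPE('u) (Arr incl_cat)"
    unfolding small_def using FFG smallG lepoll_trans lesspoll_trans1 by blast
  define sub where "sub S = G\<lparr>carrier := S\<rparr>" for S
  have carrier_sub [simp]: "carrier (sub S) = S" for S
    by (simp add: sub_def)
  have sub: "sub S \<in> Obj ?C" if "S \<in> F" for S
    using that inf is_mv_algebra_subuniverse[OF mvG]
    by (intro finite_Obj_MV_lf) (auto simp: F_def sub_def)
  define inc where "inc S T = incl_arrow G S (sub T)" for S T
  have inc: "inc S T \<in> Hom ?C (sub S) (sub T)" if "S \<in> F" "T \<in> F" "S \<subseteq> T" for S T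
    using incl_arrow_in_Hom[where G = G and S = S and T = T] sub[OF that(1)] sub[OF that(2)] that(3)
    by (simp add: inc_def sub_def)
  have incG: "incl_arrow G S G \<in> Hom ?C (sub S) G" if "S \<in> F" for S
    using incl_arrow_in_Hom[where G = G and S = S and T = "carrier G"] sub[OF that] G F_sub[OF that]
    by (simp add: sub_def)
  define Fo where "Fo i = sub (src i)" for i
  define Fa where "Fa u = inc (src u) (tgt u)" for u
  define c where "c i = incl_arrow G (src i) G" for i
  have is_functor: "is_functor incl_cat ?C Fo Fa"
    unfolding is_functor_def
  proof (intro conjI ballI allI is_category_incl_cat is_category_MV_lf)
    show "Fo i \<in> Obj ?C" if "i \<in> Obj incl_cat" for i
      using that by (auto simp: Obj_incl_cat Fo_def sub)
    show "Fa u \<in> Hom ?C (Fo i) (Fo j)" if "u \<in> Hom incl_cat i j" for i j u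
      using that by (auto simp: Hom_incl_cat Fo_def Fa_def inc)
    show "Fa (Id incl_cat i) = Id ?C (Fo i)" if "i \<in> Obj incl_cat" for i
      using that by (auto simp: Obj_incl_cat Fo_def Fa_def inc_def incl_arrow_def sub_def MV_lf_def)
    show "Fa (Comp incl_cat v u) = Comp ?C (Fa v) (Fa u)"
      if "u \<in> Hom incl_cat i j" "v \<in> Hom incl_cat j k" for i j k u v
      using that
      by (auto simp: Hom_incl_cat Fa_def inc_def incl_arrow_def sub_def compose_restrict_id Int_absorb1)
  qed
  have monic: "monic ?C (Fa u)" if "u \<in> Arr incl_cat" for u
  proof -
    obtain S T where "S \<in> F" "T \<in> F" "S \<subseteq> T" "u = e (S, T)"
      using \<open>u \<in> Arr incl_cat\<close> by (auto simp: incl_cat_def)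
    then show ?thesis
      using monic_MV_lf[OF inc[of S T]]
      by (simp add: Fa_def) (simp add: inc_def incl_arrow_def inj_on_def)
  qed
  have "is_colimit ?C incl_cat Fo Fa G c"
    unfolding is_colimit_def
  proof (intro conjI allI impI)
    show "is_cocone ?C incl_cat Fo Fa G c"
      unfolding is_cocone_def
    proof (intro conjI ballI allI G)
      show "c i \<in> Hom ?C (Fo i) G" if "i \<in> Obj incl_cat" for i
        using that by (auto simp: Obj_incl_cat Fo_def c_def incG)
      show "Comp ?C (c j) (Fa u) = c i" if "u \<in> Hom incl_cat i j" for i j u
        using that
        by (auto simp: Hom_incl_cat Fa_def c_def inc_def incl_arrow_def compose_restrict_id Int_absorb1)
    qed
    fix Z d assume d: "is_cocone ?C incl_cat Fo Fa Z d"
    then have Z: "Z \<in> Obj ?C" by (simp add: is_cocone_def)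
    define f where "f S = fst (snd (d (e (S, S))))" for S
    have f: "d (e (S, S)) = (sub S, f S, Z)" "mv_morphism (sub S) Z (f S)" "f S \<in> extensional S"
      if "S \<in> F" for S
    proof -
      have "d (e (S, S)) \<in> Hom ?C (Fo (e (S, S))) Z"
        using d e_in_Obj[OF that] unfolding is_cocone_def by blast
      then have "d (e (S, S)) \<in> Hom ?C (sub S) Z"
        using that by (simp add: Fo_def)
      then show "d (e (S, S)) = (sub S, f S, Z)" "mv_morphism (sub S) Z (f S)" "f S \<in> extensional S"
        by (auto simp: Hom_MV_lf f_def)
    qed
    have compat: "f T x = f S x" if "S \<in> F" "T \<in> F" "S \<subseteq> T" "x \<in> S" for S T x
    proof -
      have "Comp ?C (d (e (T, T))) (Fa (e (S, T))) = d (e (S, S))"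
        using d e_in_Hom[OF that(1-3)] unfolding is_cocone_def by blast
      then have "restrict (f T) S = f S"
        using that by (simp add: f(1) Fa_def inc_def incl_arrow_def compose_restrict_id)
      then show ?thesis
        using \<open>x \<in> S\<close> by (metis restrict_apply')
    qed
    \<comment> \<open>The glued map takes its value at \<open>x\<close> from the smallest member of
      \<open>F\<close> containing \<open>x\<close>; by \<open>compat\<close>, every other member
      containing \<open>x\<close> gives the same value.\<close>
    define m where "m x = f (mv_generated G {x}) x" for x
    have m_eq: "m x = f S x" if "S \<in> F" "x \<in> S" for S x
    proof -
      have "mv_generated G {x} \<in> F"
        using F_sub that by (intro gen_F) auto
      moreover have "mv_generated G {x} \<subseteq> S"
        using that by (intro mv_generated_least) (auto simp: F_def)
      ultimately show ?thesis
        unfolding m_def using that mv_generated_superset[of "{x}" G] by (intro compat[symmetric]) auto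
    qed
    have finite_F: "\<exists>S\<in>F. X \<subseteq> S" if "X \<subseteq> carrier G" "finite X" for X
      by (intro bexI[of _ "mv_generated G X"] gen_F that mv_generated_superset)
    have "mv_morphism G Z m"
      unfolding mv_morphism_def
    proof (intro conjI ballI)
      have at: "f S \<zero>\<^bsub>G\<^esub> = \<zero>\<^bsub>Z\<^esub>" "x \<in> S \<Longrightarrow> f S x \<in> carrier Z"
        "x \<in> S \<Longrightarrow> f S (\<sim>\<^bsub>G\<^esub> x) = \<sim>\<^bsub>Z\<^esub> f S x"
        "x \<in> S \<Longrightarrow> y \<in> S \<Longrightarrow> f S (x \<oplus>\<^bsub>G\<^esub> y) = f S x \<oplus>\<^bsub>Z\<^esub> f S y" if "S \<in> F" for S x y
        using mv_morphismD[OF f(2)[OF that]] by (simp_all add: sub_def)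
      have closed: "\<zero>\<^bsub>G\<^esub> \<in> S" "x \<in> S \<Longrightarrow> \<sim>\<^bsub>G\<^esub> x \<in> S" "x \<in> S \<Longrightarrow> y \<in> S \<Longrightarrow> x \<oplus>\<^bsub>G\<^esub> y \<in> S"
        if "S \<in> F" for S x y
        using that by (auto simp: F_def intro: mv_subuniverseD)
      obtain S0 where "S0 \<in> F" using nonempty by blast
      then show "m \<zero>\<^bsub>G\<^esub> = \<zero>\<^bsub>Z\<^esub>"
        using m_eq closed(1) at(1) by simp
      show "m \<in> carrier G \<rightarrow> carrier Z"
      proof
        fix x assume "x \<in> carrier G"
        then obtain S where "S \<in> F" "x \<in> S" using finite_F[of "{x}"] by auto
        then show "m x \<in> carrier Z" using m_eq at(2) by simp
      qed
      fix x assume x: "x \<in> carrier G"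
      then obtain S where "S \<in> F" "x \<in> S" using finite_F[of "{x}"] by auto
      then show "m (\<sim>\<^bsub>G\<^esub> x) = \<sim>\<^bsub>Z\<^esub> m x"
        using m_eq[of S] closed(2)[of S] at(3)[of S] by simp
      fix y assume "y \<in> carrier G"
      with x obtain T where "T \<in> F" "x \<in> T" "y \<in> T" using finite_F[of "{x, y}"] by auto
      then show "m (x \<oplus>\<^bsub>G\<^esub> y) = m x \<oplus>\<^bsub>Z\<^esub> m y"
        using m_eq[of T] closed(3)[of T] at(4)[of T] by simp
    qed
    define m' where "m' = (G, restrict m (carrier G), Z)"
    have m': "m' \<in> Hom ?C G Z"
      using restrict_in_Hom_MV_lf[OF G Z \<open>mv_morphism G Z m\<close>] by (simp add: m'_def)
    have m'_comp: "Comp ?C m' (c i) = d i" if "i \<in> Obj incl_cat" for i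
    proof -
      obtain S where S: "S \<in> F" "i = e (S, S)" using \<open>i \<in> Obj incl_cat\<close> by (auto simp: Obj_incl_cat)
      have "compose S (restrict m (carrier G)) (\<lambda>x\<in>S. x) = f S"
        using S(1) F_sub[OF S(1)] f(3)[OF S(1)] m_eq[OF S(1)]
        by (intro ext) (auto simp: compose_def extensional_def)
      then show ?thesis
        using S by (simp add: m'_def c_def incl_arrow_def f(1) sub_def)
    qed
    show "\<exists>!m. m \<in> Hom ?C G Z \<and> (\<forall>i\<in>Obj incl_cat. Comp ?C m (c i) = d i)"
    proof (rule ex1I[of _ m'])
      show "m' \<in> Hom ?C G Z \<and> (\<forall>i\<in>Obj incl_cat. Comp ?C m' (c i) = d i)"
        using m' m'_comp by blast
      fix n assume n: "n \<in> Hom ?C G Z \<and> (\<forall>i\<in>Obj incl_cat. Comp ?C n (c i) = d i)"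
      then obtain h where h: "n = (G, h, Z)" "h \<in> extensional (carrier G)"
        by (auto simp: Hom_MV_lf)
      have "h x = restrict m (carrier G) x" if x: "x \<in> carrier G" for x
      proof -
        obtain S where S: "S \<in> F" "x \<in> S" using finite_F[of "{x}"] x by auto
        then have "Comp ?C n (c (e (S, S))) = d (e (S, S))"
          using n e_in_Obj by blast
        then have "restrict h S = f S"
          using S by (simp add: h(1) c_def incl_arrow_def f(1) compose_restrict_id)
        then have "h x = f S x"
          using S(2) by (metis restrict_apply')
        then show ?thesis using S m_eq x by simp
      qed
      then have "h = restrict m (carrier G)"
        by (intro extensionalityI[OF h(2)]) auto
      then show "n = m'" by (simp add: h(1) m'_def)
    qed
  qed
  then have colim: "is_colimit set_category incl_cat (Hom ?C G \<circ> Fo) (hom_functor_arr ?C G \<circ> Fa)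
      (Hom ?C G G) (hom_functor_arr ?C G \<circ> c)"
    using fg smallO smallA filtered_incl_cat is_functor monic
    unfolding finitely_generated_object_def preserves_colimits_of_def by blast
  have id: "Id ?C G \<in> Hom ?C G G"
    using is_category_MV_lf G unfolding is_category_def by blast
  \<comment> \<open>These yield two distinct values of the arrow type, the test points for
    \<open>set_category_colimit_jointly_surjective\<close>; they need not be arrows of the
    category.\<close>
  obtain x y :: 'u where "x \<noteq> y"
    using inf by (metis UNIV_I finite.emptyI finite_insert finite_subset insertI1 subsetI)
  then have ne: "(G, (\<lambda>_ :: 'u. x), G) \<noteq> (G, (\<lambda>_. y), G)"
    by (auto simp: fun_eq_iff)
  have Ha: "(hom_functor_arr ?C G \<circ> Fa) u \<in> Hom set_category ((Hom ?C G \<circ> Fo) i) ((Hom ?C G \<circ> Fo) j)"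
    if "u \<in> Hom incl_cat i j" for i j u
    using is_functor_hom[OF is_category_MV_lf G] is_functor that by (simp add: is_functor_def)
  \<comment> \<open>The identity of \<open>G\<close> is a point of the colimit of the hom sets, so
    it comes from some stage: the inclusion of a finite subalgebra after \<open>a\<close> is the
    identity.\<close>
  obtain i a where i: "i \<in> Obj incl_cat" and a: "a \<in> Hom ?C G (Fo i)"
    "fst (snd (hom_functor_arr ?C G (c i))) a = Id ?C G"
    using set_category_colimit_jointly_surjective[OF colim is_category_incl_cat Ha id ne] by auto
  then obtain S where S: "S \<in> F" "i = e (S, S)" by (auto simp: Obj_incl_cat)
  obtain f where f: "a = (G, f, sub S)" "mv_morphism G (sub S) f"
    using a(1) S by (auto simp: Hom_MV_lf Fo_def)
  have "Comp ?C (c i) a = Id ?C G"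
    using a S by (simp add: hom_functor_arr_def Fo_def c_def incl_arrow_def sub_def)
  then have eq: "compose (carrier G) (\<lambda>x\<in>S. x) f = (\<lambda>x\<in>carrier G. x)"
    using S by (simp add: c_def incl_arrow_def f(1) MV_lf_def)
  have "x \<in> S" if "x \<in> carrier G" for x
    using fun_cong[OF eq, of x] that mv_morphismD(1)[OF f(2) that] by (simp add: compose_def)
  then have "carrier G \<subseteq> S" by blast
  then show False
    using S infG finite_subset by (auto simp: F_def)
qed

section \<open>No finite regularly generating set\<close>

text \<open>From \<open>j / m = k / n\<close> it follows that \<open>m\<close> divides
  \<open>j * n\<close> and hence \<open>j\<close>; as \<open>j \<le> m\<close>, only the endpoints
  remain.\<close>

lemma rational_chain_coprime:
  assumes "coprime m n" "m > 0" "n > 0" "x \<in> rational_chain m" "x \<in> rational_chain n"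
  shows "x \<in> {0, 1}"
proof -
  obtain j where j: "j \<le> m" "x = real j / real m"
    using assms(4) by (auto simp: rational_chain_def)
  obtain k where k: "x = real k / real n"
    using assms(5) by (auto simp: rational_chain_def)
  then have "real (j * n) = real (k * m)"
    using j(2) k assms(2,3) by (simp add: field_simps)
  then have "m dvd j * n"
    by (metis dvd_triv_right of_nat_eq_iff)
  then have "m dvd j"
    using assms(1) by (simp add: coprime_dvd_mult_left_iff)
  then have "j = 0 \<or> j = m"
    using j(1) dvd_imp_le by fastforce
  then show ?thesis
    using j(2) assms(2) by auto
qed

text \<open>For \<open>n = 2 * q + 1\<close> the element \<open>q / n\<close> is below one half.
  Doubling its complement forces a two-valued map to send it to 0, but three copies of it reach
  1.\<close>

lemma rational_chain_odd_not_two_valued: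
  assumes f: "mv_morphism (real_mv (rational_chain n)) unit_mv f" and "odd n" "n \<noteq> 1"
  shows "\<exists>x\<in>rational_chain n. f x \<notin> {0, 1}"
proof (rule ccontr)
  assume "\<not> ?thesis"
  then have two: "f x = 0 \<or> f x = 1" if "x \<in> rational_chain n" for x
    using that by blast
  obtain q where n: "n = 2 * q + 1" using \<open>odd n\<close> by (elim oddE)
  with \<open>n \<noteq> 1\<close> have "q \<ge> 1" by simp
  define w where "w = real q / real n"
  have sub: "mv_subuniverse unit_mv (rational_chain n)"
    using n by (intro mv_subuniverse_rational_chain) simp
  have "w \<in> rational_chain n"
    unfolding w_def rational_chain_def using n by (intro imageI) simp
  then have in_chain: "0 \<in> rational_chain n" "w \<in> rational_chain n" "1 - w \<in> rational_chain n"
      "min 1 (w + w) \<in> rational_chain n"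
    using mv_subuniverseD(3)[OF sub] mv_subuniverseD(4)[OF sub, of w] mv_subuniverseD(5)[OF sub, of w w]
    by simp_all
  \<comment> \<open>The lower bound uses \<open>q \<ge> 1\<close> and makes three copies of
    \<open>w\<close> reach 1; the upper bound makes two copies of \<open>1 - w\<close> reach
    1.\<close>
  have w: "1/3 \<le> w" "w \<le> 1/2"
    using \<open>q \<ge> 1\<close> by (simp_all add: w_def n field_simps)
  note f = mv_morphismD(2-4)[OF f]
  have f1: "f 1 = 1" using f(2)[of 0] f(1) in_chain by simp
  have "f 1 = min 1 (f (1 - w) + f (1 - w))"
    using f(3)[of "1 - w" "1 - w"] in_chain w by (simp add: min_def)
  then have "f (1 - w) = 1" using f1 two[OF in_chain(3)] by auto
  then have "f w = 0" using f(2)[of w] in_chain by simp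
  moreover have "min 1 (min 1 (w + w) + w) = 1"
    using w by (simp add: min_def)
  then have "f 1 = min 1 (f (min 1 (w + w)) + f w)"
    using f(3)[of "min 1 (w + w)" w] in_chain by simp
  moreover have "f (min 1 (w + w)) = min 1 (f w + f w)"
    using f(3)[of w w] in_chain by simp
  ultimately show False using f1 by simp
qed

section \<open>The two-element subalgebra, finite hom sets and factored regular epimorphisms\<close>

lemma mv_subuniverse_zero_one:
  assumes "is_mv_algebra A"
  shows "mv_subuniverse A {\<zero>\<^bsub>A\<^esub>, \<sim>\<^bsub>A\<^esub> \<zero>\<^bsub>A\<^esub>}"
proof -
  interpret mv_alg A by unfold_locales fact
  show ?thesis by (auto simp: mv_subuniverse_def)
qed

lemma finite_Hom_MV_lf:
  assumes "finite (carrier A)" "finite (carrier B)"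
  shows "finite (Hom (MV_lf TYPE('u)) A (B :: 'u mv_algebra))"
proof (rule finite_subset)
  show "Hom (MV_lf TYPE('u)) A B \<subseteq> (\<lambda>f. (A, f, B)) ` (carrier A \<rightarrow>\<^sub>E carrier B)"
    by (auto simp: Hom_MV_lf mv_morphism_def PiE_iff Pi_iff extensional_def intro!: imageI)
  show "finite ((\<lambda>f. (A, f, B)) ` (carrier A \<rightarrow>\<^sub>E carrier B))"
    using assms by (intro finite_imageI finite_PiE) auto
qed

text \<open>As \<open>j\<close> is monic, \<open>m\<close> already merges the pair of which
  \<open>Comp C j m\<close> is a coequaliser, and the universal property applied to \<open>m\<close>
  yields an arrow back to \<open>Dom C j\<close>.\<close>

lemma regular_epic_factor_monic:
  assumes C: "is_category C" and j: "monic C j" and "m \<in> Hom C Q (Dom C j)"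
    and epi: "regular_epic C (Comp C j m)"
  shows "Hom C (Cod C j) (Dom C j) \<noteq> {}"
proof -
  have jH: "j \<in> Hom C (Dom C j) (Cod C j)"
    using j by (simp add: monic_def Hom_def)
  have assoc: "Comp C h (Comp C g f) = Comp C (Comp C h g) f"
    if "f \<in> Hom C W X" "g \<in> Hom C X Y" "h \<in> Hom C Y Z" for f g h W X Y Z
    using C that unfolding is_category_def by blast
  have comp: "Comp C g f \<in> Hom C X Z" if "f \<in> Hom C X Y" "g \<in> Hom C Y Z" for f g X Y Z
    using C that unfolding is_category_def by blast
  have jm: "Comp C j m \<in> Hom C Q (Cod C j)"
    using assms(3) jH by (rule comp)
  obtain f g X Y R where fg: "f \<in> Hom C X Y" "g \<in> Hom C X Y" "Comp C j m \<in> Hom C Y R"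
    and eq: "Comp C (Comp C j m) f = Comp C (Comp C j m) g"
    and univ: "\<And>Z h. \<lbrakk>h \<in> Hom C Y Z; Comp C h f = Comp C h g\<rbrakk> \<Longrightarrow>
      \<exists>!k. k \<in> Hom C R Z \<and> Comp C k (Comp C j m) = h"
    using epi unfolding regular_epic_def is_coequaliser_def by blast
  have YR: "Y = Q" "R = Cod C j"
    using fg(3) jm by (auto simp: Hom_def)
  have "Comp C m f = Comp C m g"
    using j eq comp[of f X Y m] comp[of g X Y m] assms(3) assoc[of f X Y m "Dom C j" j]
      assoc[of g X Y m "Dom C j" j] fg jH
    unfolding monic_def YR by metis
  then show ?thesis
    using univ[of m "Dom C j"] assms(3) unfolding YR by blast
qed

theorem proposition3p15:
  assumes "infinite (UNIV :: 'u set)"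
  shows "\<not> (\<exists>\<G> :: 'u mv_algebra set.
           finite \<G> \<and>
           (\<forall>G \<in> \<G>. finitely_generated_object TYPE('u) (MV_lf TYPE('u)) G) \<and>
           regularly_generating (MV_lf TYPE('u)) \<G>)"
proof
  let ?C = "MV_lf TYPE('u)"
  assume "\<exists>\<G> :: 'u mv_algebra set. finite \<G> \<and>
    (\<forall>G \<in> \<G>. finitely_generated_object TYPE('u) ?C G) \<and> regularly_generating ?C \<G>"
  then obtain \<G> :: "'u mv_algebra set" where fin\<G>: "finite \<G>"
    and fg: "\<And>G. G \<in> \<G> \<Longrightarrow> finitely_generated_object TYPE('u) ?C G"
    and rg: "regularly_generating ?C \<G>"
    by blast
  have finG: "finite (carrier G)" and GO: "G \<in> Obj ?C" if "G \<in> \<G>" for G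
    using finitely_generated_object_imp_finite[OF assms fg[OF that]] fg[OF that]
    by (simp_all add: finitely_generated_object_def)
  obtain M where M: "\<And>G. G \<in> \<G> \<Longrightarrow> card (carrier G) \<le> M"
    using finite_imageI[OF fin\<G>, of "\<lambda>G. card (carrier G)"]
    by (metis finite_nat_set_iff_bounded_le imageI)
  \<comment> \<open>Every \<open>d\<close> with \<open>0 < d < M\<close> divides
    \<open>2 * fact M\<close> and so is coprime to \<open>p\<close>; the factor 2 makes
    \<open>p\<close> odd.\<close>
  define p :: nat where "p = 2 * fact M + 1"
  have "odd p" "p > 0" "p \<noteq> 1" by (simp_all add: p_def)
  define L where "L = real_mv (rational_chain p)"
  have L: "is_mv_algebra L"
    unfolding L_def using \<open>p > 0\<close> by (intro is_mv_algebra_real_mv mv_subuniverse_rational_chain)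
  have carrier_L: "carrier L = rational_chain p" by (simp add: L_def)
  \<comment> \<open>The chain is copied into \<open>'u\<close> to become an object \<open>A\<close>;
    \<open>c\<close> inverts the copying map \<open>b\<close>.\<close>
  obtain b :: "real \<Rightarrow> 'u" where b: "inj_on b (carrier L)"
    using finite_lepoll_infinite[OF assms finite_rational_chain[of p]] by (auto simp: lepoll_def carrier_L)
  define c where "c = inv_into (carrier L) b"
  obtain A where A: "is_mv_algebra A" "carrier A = b ` carrier L" "mv_morphism L A b" "mv_morphism A L c"
    unfolding c_def using mv_transport[OF L b] by blast
  have bc: "b (c x) = x" if "x \<in> carrier A" for x
    using that by (simp add: c_def A(2) f_inv_into_f)
  have finA: "finite (carrier A)" by (simp add: A(2) carrier_L)
  have AO: "A \<in> Obj ?C" using assms A(1) finA by (rule finite_Obj_MV_lf)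
  have L_unit: "mv_morphism L unit_mv (\<lambda>x. x)"
    using mv_subuniverseD(1)[OF mv_subuniverse_rational_chain[OF \<open>p > 0\<close>]]
    by (auto simp: mv_morphism_def L_def)
  note c_unit = mv_morphism_comp[OF A(4) L_unit]
  \<comment> \<open>The two-element subalgebra that will contain the image of every homomorphism to
    \<open>A\<close> from a member of \<open>\<G>\<close>.\<close>
  define D where "D = {\<zero>\<^bsub>A\<^esub>, \<sim>\<^bsub>A\<^esub> \<zero>\<^bsub>A\<^esub>}"
  have D: "mv_subuniverse A D"
    unfolding D_def by (rule mv_subuniverse_zero_one) fact
  define B where "B = A\<lparr>carrier := D\<rparr>"
  have BO: "B \<in> Obj ?C"
    using assms is_mv_algebra_subuniverse[OF A(1) D] unfolding B_def
    by (intro finite_Obj_MV_lf) (simp_all add: D_def)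
  have in_D: "x \<in> D \<longleftrightarrow> c x \<in> {0, 1}" if "x \<in> carrier A" for x
  proof -
    have "c \<zero>\<^bsub>A\<^esub> = 0" "c (\<sim>\<^bsub>A\<^esub> \<zero>\<^bsub>A\<^esub>) = 1"
      using mv_morphismD(2,3)[OF A(4)] is_mv_algebraD(1)[OF A(1)] by (simp_all add: L_def)
    moreover have "\<zero>\<^bsub>A\<^esub> \<in> carrier A" "\<sim>\<^bsub>A\<^esub> \<zero>\<^bsub>A\<^esub> \<in> carrier A"
      using is_mv_algebraD(1,2)[OF A(1)] by auto
    ultimately show ?thesis
      unfolding D_def using bc that by (metis insert_iff singletonD)
  qed
  have D_sub: "D \<subseteq> carrier A" using mv_subuniverseD(1)[OF D] .
  define j where "j = incl_arrow A D A"
  have j: "j \<in> Hom ?C B A"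
    using incl_arrow_in_Hom[where G = A and S = D and T = "carrier A"] BO AO D_sub
    by (simp add: j_def B_def)
  then have "monic ?C j"
    by (rule monic_MV_lf) (simp add: j_def incl_arrow_def B_def inj_on_def)
  \<comment> \<open>Read in the unit interval, the image of \<open>h\<close> lies both in the chain
    for \<open>p\<close> and in one for a denominator coprime to \<open>p\<close>, hence in
    \<open>{0, 1}\<close>.\<close>
  have factor: "\<exists>h'. h' \<in> Hom ?C G B \<and> Comp ?C j h' = h"
    if G: "G \<in> \<G>" and h: "h \<in> Hom ?C G A" for G h
  proof -
    obtain f where f: "h = (G, f, A)" "mv_morphism G A f" "f \<in> extensional (carrier G)"
      using h by (auto simp: Hom_MV_lf)
    obtain d where d: "0 < d" "d < M" "(\<lambda>x. c (f x)) ` carrier G \<subseteq> rational_chain d"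
      using mv_morphism_into_rational_chain[OF Obj_MV_lfD(1)[OF GO[OF G]] finG[OF G] M[OF G]
          mv_morphism_comp[OF f(2) c_unit]] by blast
    have "d dvd 2 * fact M"
      using d by (intro dvd_mult dvd_fact) auto
    then have "coprime d p"
      unfolding p_def by (meson coprime_add_one_right coprime_divisors dvd_refl)
    have "f ` carrier G \<subseteq> D"
    proof
      fix y assume "y \<in> f ` carrier G"
      then obtain x where x: "x \<in> carrier G" "y = f x" by blast
      then have "c y \<in> rational_chain p"
        using mv_morphismD(1)[OF mv_morphism_comp[OF f(2) A(4)]] by (simp add: carrier_L)
      moreover have "c y \<in> rational_chain d" using d(3) x by blast
      ultimately have "c y \<in> {0, 1}"
        using rational_chain_coprime[OF \<open>coprime d p\<close> d(1) \<open>p > 0\<close>] by blast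
      then show "y \<in> D" using in_D mv_morphismD(1)[OF f(2) x(1)] x(2) by simp
    qed
    then have "mv_morphism G B f"
      unfolding B_def by (rule mv_morphism_into_subuniverse[OF f(2)])
    moreover have "compose (carrier G) (\<lambda>x\<in>D. x) f = f"
      using f(3) \<open>f ` carrier G \<subseteq> D\<close> by (intro ext) (auto simp: compose_def extensional_def)
    ultimately show ?thesis
      using GO[OF G] BO f(1,3) by (intro exI[of _ "(G, f, B)"]) (auto simp: Hom_MV_lf j_def incl_arrow_def)
  qed
  \<comment> \<open>Hom sets between finite algebras are finite, so there are finitely many summands
    and the coproduct exists. Without an actual coproduct, \<open>regularly_generating\<close> would
    say nothing about \<open>A\<close>.\<close>
  define I where "I = (SIGMA G:\<G>. Hom ?C G A)"
  have "finite I"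
    unfolding I_def using fin\<G> finG finA by (intro finite_SigmaI finite_Hom_MV_lf)
  moreover have "fst i \<in> Obj ?C" "finite (carrier (fst i))" if "i \<in> I" for i
    using that GO finG by (auto simp: I_def)
  ultimately obtain Q \<kappa> where cop: "is_coproduct ?C I fst Q \<kappa>"
    using MV_lf_finite_coproduct_exists[OF assms, of I fst] by blast
  have \<kappa>: "\<kappa> i \<in> Hom ?C (fst i) Q" if "i \<in> I" for i
    using cop that by (simp add: is_coproduct_def)
  obtain k where k: "\<And>i. i \<in> I \<Longrightarrow> k i \<in> Hom ?C (fst i) B \<and> Comp ?C j (k i) = snd i"
  proof -
    have "\<forall>i\<in>I. \<exists>h'. h' \<in> Hom ?C (fst i) B \<and> Comp ?C j h' = snd i"
      using factor by (auto simp: I_def)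
    then show ?thesis using that by metis
  qed
  \<comment> \<open>The corestrictions \<open>k i\<close> assemble into one arrow, so that
    \<open>Comp ?C j m\<close> has the defining property of the canonical arrow.\<close>
  obtain m where m: "m \<in> Hom ?C Q B" "\<And>i. i \<in> I \<Longrightarrow> Comp ?C m (\<kappa> i) = k i"
    using cop k BO unfolding is_coproduct_def by metis
  have jm: "Comp ?C j m \<in> Hom ?C Q A"
    using is_category_MV_lf m(1) j unfolding is_category_def by blast
  have jm_comp: "Comp ?C (Comp ?C j m) (\<kappa> i) = snd i" if "i \<in> I" for i
  proof -
    have "Comp ?C (Comp ?C j m) (\<kappa> i) = Comp ?C j (Comp ?C m (\<kappa> i))"
      using is_category_MV_lf \<kappa>[OF that] m(1) j unfolding is_category_def by metis
    then show ?thesis using m(2) k that by simp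
  qed
  have "\<forall>i\<in>I. snd i \<in> Hom ?C (fst i) A"
    by (auto simp: I_def)
  then have "\<exists>!m. m \<in> Hom ?C Q A \<and> (\<forall>i\<in>I. Comp ?C m (\<kappa> i) = snd i)"
    using cop AO unfolding is_coproduct_def by blast
  then have "(THE m. m \<in> Hom ?C Q A \<and> (\<forall>i\<in>I. Comp ?C m (\<kappa> i) = snd i)) = Comp ?C j m"
    using jm jm_comp by (intro the1_equality) auto
  moreover have "regular_epic ?C (THE m. m \<in> Hom ?C Q A \<and>
      (\<forall>G\<in>\<G>. \<forall>h\<in>Hom ?C G A. Comp ?C m (\<kappa> (G, h)) = h))"
    using rg AO cop unfolding regularly_generating_def I_def by blast
  ultimately have "regular_epic ?C (Comp ?C j m)"
    by (simp add: I_def)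
  moreover have "Dom ?C j = B" "Cod ?C j = A"
    using j by (simp_all add: Hom_def)
  ultimately have "Hom ?C A B \<noteq> {}"
    using regular_epic_factor_monic[OF is_category_MV_lf \<open>monic ?C j\<close>, of m Q] m(1) by simp
  then obtain r where r: "mv_morphism A B r"
    by (auto simp: Hom_MV_lf)
  \<comment> \<open>Regarded as an endomorphism of \<open>A\<close>, \<open>r\<close> can be
    composed with \<open>b\<close> and \<open>c\<close> to a two-valued homomorphism on the rational
    chain.\<close>
  have rA: "mv_morphism A A r"
    using r D_sub by (auto simp: mv_morphism_def B_def)
  have "mv_morphism (real_mv (rational_chain p)) unit_mv (\<lambda>x. c (r (b x)))"
    using mv_morphism_comp[OF mv_morphism_comp[OF A(3) rA] c_unit] by (simp add: L_def)
  then obtain x where x: "x \<in> rational_chain p" "c (r (b x)) \<notin> {0, 1}"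
    using rational_chain_odd_not_two_valued \<open>odd p\<close> \<open>p \<noteq> 1\<close> by blast
  moreover have "b x \<in> carrier A" using x(1) by (simp add: A(2) carrier_L)
  then have "r (b x) \<in> D" using mv_morphismD(1)[OF r] by (simp add: B_def)
  ultimately show False using in_D D_sub by blast
qed

end
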